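(* Let $k\ge 3$, $n\ge k-1$ and $m$ be integers. Then $$N_k(m,n+1)\ge N_k(m,n),$$ except for the cases $n=|m|+k-1$ and $(k,m,n)=(3,0,8)$. (That is, the inequality holds whenever $n\ne |m|+k-1$ and $(k,m,n)\neq(3,0,8)$.)
   Context: For a positive integer $k$ and an integer $m$, the integers $N_k(m,n)$, $n\ge 0$, are defined by the power series identity $$\sum_{n=0}^{\infty}N_k(m,n)q^n=\frac{1}{(q;q)_\infty}\sum_{r=1}^{\infty}(-1)^{r-1}q^{r((2k-1)r-1)/2+|m|r}(1-q^r),$$ where $(q;q)_\infty=\prod_{i\ge 1}(1-q^i)$. ($N_k(m,n)$ is the counting function of Garvan's $k$-rank.) *)

theory Defs
  imports "HOL-Analysis.Analysis"
begin

text \<open>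
  All series are formal power series over the integers; infinite sums and products are
  the library's limits with respect to the topology of coefficientwise stabilisation.
\<close>

definition q_pochhammer_inf :: "int fps" where
  "q_pochhammer_inf = (\<Prod>i. 1 - fps_X ^ Suc i)"

text \<open>
  The exponent is a natural number for \<open>k \<ge> 1\<close> and \<open>r \<ge> 1\<close>: the truncated subtractions are
  then genuine, and the division by 2 is exact because \<open>r\<close> or \<open>(2 * k - 1) * r - 1\<close> is even.
\<close>

definition k_rank_exponent :: "nat \<Rightarrow> int \<Rightarrow> nat \<Rightarrow> nat" where
  "k_rank_exponent k m r = r * ((2 * k - 1) * r - 1) div 2 + nat \<bar>m\<bar> * r"

definition k_rank_term :: "nat \<Rightarrow> int \<Rightarrow> nat \<Rightarrow> int fps" where
  "k_rank_term k m r = (- 1) ^ (r - 1) * fps_X ^ k_rank_exponent k m r * (1 - fps_X ^ r)"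

text \<open>
  Over the integers the reciprocal of a series with constant coefficient 1 is
  \<^term>\<open>fps_right_inverse f 1\<close>; the class-based \<^term>\<open>inverse\<close> needs coefficients in a field.
  The summation index is shifted so that \<open>r = Suc j\<close> ranges over the positive integers.
\<close>

definition k_rank_gf :: "nat \<Rightarrow> int \<Rightarrow> int fps" where
  "k_rank_gf k m = fps_right_inverse q_pochhammer_inf 1 * (\<Sum>j. k_rank_term k m (Suc j))"

definition N_rank :: "nat \<Rightarrow> int \<Rightarrow> nat \<Rightarrow> int" where
  "N_rank k m n = fps_nth (k_rank_gf k m) n"

text \<open>The remaining facts show that the limits and the reciprocal above exist.\<close>

lemma k_rank_exponent_eq:
  assumes "k \<ge> 1" "r \<ge> 1"
  shows "2 * int (k_rank_exponent k m r) = int r * ((2 * int k - 1) * int r - 1) + 2 * \<bar>m\<bar> * int r"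
proof -
  have ge: "(2 * k - 1) * r \<ge> 1" using assms by (simp add: Suc_le_eq)
  have "even (r * ((2 * k - 1) * r - 1))"
    using assms ge by (cases "even r") auto
  then have "2 * (r * ((2 * k - 1) * r - 1) div 2) = r * ((2 * k - 1) * r - 1)"
    by simp
  then have "2 * int (r * ((2 * k - 1) * r - 1) div 2) = int (r * ((2 * k - 1) * r - 1))"
    by (metis of_nat_mult of_nat_numeral)
  also have "\<dots> = int r * ((2 * int k - 1) * int r - 1)"
    using assms ge by (simp add: of_nat_diff)
  finally show ?thesis by (simp add: k_rank_exponent_def algebra_simps)
qed

lemma le_k_rank_exponent:
  assumes "k \<ge> 1"
  shows "r \<le> k_rank_exponent k m r + 1"
proof (cases "r = 0")
  case False
  have "int r * (int r - 1) \<le> int r * ((2 * int k - 1) * int r - 1)"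
    using assms mult_right_mono[of 1 "2 * int k - 1" "int r"] by (intro mult_left_mono) auto
  moreover have "0 \<le> (int r - 1) * (int r - 2)"
    using False by (cases "r = 1") auto
  then have "2 * int r \<le> int r * (int r - 1) + 2"
    by (simp add: algebra_simps)
  moreover have "0 \<le> 2 * \<bar>m\<bar> * int r"
    by simp
  moreover have "2 * int (k_rank_exponent k m r) =
      int r * ((2 * int k - 1) * int r - 1) + 2 * \<bar>m\<bar> * int r"
    using assms False by (intro k_rank_exponent_eq) auto
  ultimately show ?thesis by linarith
qed simp

lemma has_prod_q_pochhammer_inf:
  "(\<lambda>i. 1 - fps_X ^ Suc i :: int fps) has_prod q_pochhammer_inf"
  and fps_nth_q_pochhammer_inf:
  "fps_nth q_pochhammer_inf n = fps_nth (\<Prod>i\<le>n. 1 - fps_X ^ Suc i) n"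
proof -
  define P where "P N = (\<Prod>i\<le>N. 1 - fps_X ^ Suc i :: int fps)" for N
  define F where "F = Abs_fps (\<lambda>n. fps_nth (P n) n)"
  have step: "fps_nth (P (Suc N)) n = fps_nth (P N) n" if "n \<le> N" for N n
    using that by (simp add: P_def right_diff_distrib fps_X_power_mult_right_nth del: power_Suc)
  have stable: "fps_nth (P N) n = fps_nth F n" if "n \<le> N" for N n
    using that by (induction rule: dec_induct) (simp_all add: F_def step)
  have "P \<longlonglongrightarrow> F"
    by (rule tendsto_fpsI) (auto intro!: eventually_sequentiallyI stable)
  moreover have "fps_nth F 0 = 1"
    by (simp add: F_def P_def)
  then have "F \<noteq> 0" by auto
  ultimately have "raw_has_prod (\<lambda>i. 1 - fps_X ^ Suc i :: int fps) 0 F"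
    by (simp add: raw_has_prod_def P_def[abs_def])
  then have prod: "(\<lambda>i. 1 - fps_X ^ Suc i :: int fps) has_prod F"
    by (simp add: has_prod_def)
  then have "q_pochhammer_inf = F"
    unfolding q_pochhammer_inf_def by (rule has_prod_unique[symmetric])
  then show "(\<lambda>i. 1 - fps_X ^ Suc i :: int fps) has_prod q_pochhammer_inf"
    "fps_nth q_pochhammer_inf n = fps_nth (\<Prod>i\<le>n. 1 - fps_X ^ Suc i) n"
    using prod stable[of n n] by (simp_all add: P_def)
qed

lemma summable_k_rank_term:
  assumes "k \<ge> 1"
  shows "summable (\<lambda>j. k_rank_term k m (Suc j))"
proof -
  define S where "S N = (\<Sum>j<N. k_rank_term k m (Suc j))" for N
  define F where "F = Abs_fps (\<lambda>n. fps_nth (S (Suc n)) n)"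
  have zero: "fps_nth (k_rank_term k m (Suc j)) n = 0" if "n < j" for n j
  proof -
    have "n < k_rank_exponent k m (Suc j)"
      using le_k_rank_exponent[OF assms, of "Suc j" m] that by simp
    moreover have "k_rank_term k m (Suc j) =
        fps_X ^ k_rank_exponent k m (Suc j) * ((- 1) ^ j * (1 - fps_X ^ Suc j))"
      by (simp add: k_rank_term_def mult_ac)
    ultimately show ?thesis by (simp add: fps_X_power_mult_nth)
  qed
  have stable: "fps_nth (S N) n = fps_nth F n" if "Suc n \<le> N" for N n
    using that by (induction rule: dec_induct) (simp_all add: F_def S_def zero)
  have "S \<longlonglongrightarrow> F"
    by (rule tendsto_fpsI) (auto intro!: eventually_sequentiallyI stable)
  then have "(\<lambda>j. k_rank_term k m (Suc j)) sums F"
    by (simp add: sums_def S_def[abs_def])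
  then show ?thesis by (rule sums_summable)
qed

lemma q_pochhammer_inf_mult_k_rank_gf:
  "q_pochhammer_inf * k_rank_gf k m = (\<Sum>j. k_rank_term k m (Suc j))"
proof -
  have "q_pochhammer_inf * fps_right_inverse q_pochhammer_inf 1 = 1"
    by (rule fps_right_inverse) (simp add: fps_nth_q_pochhammer_inf)
  then show ?thesis by (simp add: k_rank_gf_def flip: mult.assoc)
qed

end

theory Submission
  imports Defs
begin

text \<open>
  Write $n_1 \ge \dots \ge n_{k-1} \ge 1$. Iterating the Bailey lemma turns the alternating series
  for the k-rank into the positive multisum
  $$\sum_n N_k(m,n) q^n = \sum_{n_1,\dots,n_{k-1}}
     \frac{q^{n_1^2+\dots+n_{k-1}^2}}{(q)_{n_1-n_2}\cdots(q)_{n_{k-2}-n_{k-1}}} C_{n_{k-1}}(m),$$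
  where $C_N(m)$ is the coefficient of $z^m$ in $1/((zq)_N(q/z)_N)$ (lemma
  \<open>k_rank_gf_multisum\<close>). The claim is about the signs of the coefficients of $1-q$ times this
  series.

  If two consecutive indices differ, one of the denominators absorbs the factor $1-q$, and the
  contribution is nonnegative. There remain the tuples with all indices equal to some $N$, which
  contribute $q^{(k-1)N^2}(1-q)C_N(m)$ (lemma \<open>bailey_beta_diff_ge\<close>). For $N=1$ this is
  $q^{k-1+|m|}/(1+q)$; adding the tuple $(2,1,\dots,1)$ leaves a single negative coefficient, at
  the exponent $k+|m|$, which is the exception $n=|m|+k-1$. For $N \ge 2$, lemma
  \<open>crank_diff_bounds\<close> shows that $(1-q)C_N(m)$ has nonnegative coefficients, except that for
  $m=0$ the coefficient of $q$ is $-1$. It is proved by induction on $N$ through the recurrence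
  that comes from the last factors of the product, with an explicit formula for $N=2$.

  For $m=0$ there is thus a loss of 1 at each exponent $(k-1)N^2+1$ with $N \ge 2$. Each of these
  is compensated by one of the tuples $(4,1)$, $(3,1,1)$, $(3,2,1,\dots,1)$, except for $k=3$ and
  $N=2$, where the exponent is 9; this is the exception $(k,m,n)=(3,0,8)$.
\<close>

section \<open>Reciprocals of finite q-factorials\<close>

text \<open>
  The geometric series $1/(1-q^i)$, for \<open>i \<ge> 1\<close>.
\<close>
definition geom :: "nat \<Rightarrow> int fps" where
  "geom i = Abs_fps (\<lambda>n. if i dvd n then 1 else 0)"

text \<open>
  The reciprocal $1/(q;q)_n$ of the finite q-factorial. Working with the reciprocal keeps every
  identity below inside the integral domain \<open>int fps\<close>.
\<close>
definition qpoch_inv :: "nat \<Rightarrow> int fps" where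
  "qpoch_inv n = (\<Prod>i=1..n. geom i)"

lemma geom_mult: "i \<ge> 1 \<Longrightarrow> geom i * (1 - fps_X ^ i) = 1"
  by (rule fps_ext)
    (auto simp: geom_def right_diff_distrib fps_X_power_mult_right_nth dvd_minus_self dvd_imp_le not_less
       intro: dvd_imp_le)

lemma qpoch_inv_0 [simp]: "qpoch_inv 0 = 1" and qpoch_inv_Suc: "qpoch_inv (Suc n) = qpoch_inv n * geom (Suc n)"
  by (simp_all add: qpoch_inv_def)

lemma qpoch_inv_mult_one_minus: "qpoch_inv (Suc n) * (1 - fps_X ^ Suc n) = qpoch_inv n"
  using geom_mult[of "Suc n"] by (simp add: qpoch_inv_Suc mult.assoc del: power_Suc)

lemma one_minus_mult_qpoch_inv: "(1 - fps_X ^ Suc n) * qpoch_inv (Suc n) = qpoch_inv n"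
  by (metis qpoch_inv_mult_one_minus mult.commute)

lemma one_minus_X_power_nonzero: "n \<ge> 1 \<Longrightarrow> 1 - fps_X ^ n \<noteq> (0 :: int fps)"
  by (metis geom_mult mult_zero_right zero_neq_one)

section \<open>The crank parts\<close>

text \<open>
  For \<open>n \<ge> 1\<close> this is the partial fraction expansion of the coefficient of $z^m$ in
  $1/((zq;q)_n (q/z;q)_n)$, that is, the generating function of pairs of partitions with parts
  at most \<open>n\<close> whose numbers of parts differ by \<open>m\<close>. The closed form is what the Bailey chain
  needs; the combinatorial content enters only through the recurrence in \<open>n\<close> proved next.
  For \<open>n = 0\<close> the empty sum is 0, not the coefficient of the empty product, which is why the
  recurrence at \<open>m = 0\<close> is stated for \<open>n \<ge> 2\<close> only.
\<close>
definition crank_part :: "nat \<Rightarrow> int \<Rightarrow> int fps" where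
  "crank_part n m = (\<Sum>r=1..n. (- 1) ^ (r - 1) * fps_X ^ (r * (r - 1) div 2 + nat \<bar>m\<bar> * r)
     * (1 - fps_X ^ r) * qpoch_inv (n - r) * qpoch_inv (n + r))"

lemma crank_part_uminus: "crank_part n (- m) = crank_part n m"
  by (simp add: crank_part_def)

text \<open>
  Comparing coefficients of $z^m$ in $(1-zq^n)(1-q^n/z)\,F_n = F_{n-1}$, where $F_n$ is the product
  above, gives the recurrence. For \<open>m \<ge> 1\<close> it holds term by term in the closed form, because
  $1+q^{2n}-q^n(q^r+q^{-r}) = (1-q^{n-r})(1-q^{n+r})$.
\<close>
lemma crank_part_rec_pos:
  assumes "n \<ge> 1" "m \<ge> 1"
  shows "(1 + fps_X ^ (2 * n)) * crank_part n m - fps_X ^ n * (crank_part n (m - 1) + crank_part n (m + 1)) = crank_part (n - 1) m"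
proof -
  obtain a where m: "m = int (Suc a)"
    using assms by (metis Suc_nat_eq_nat_zadd1 nat_0_le int_nat_eq le_add_diff_inverse zle_iff_zadd add.commute nat_int of_nat_Suc of_nat_1)
  obtain N where n: "n = Suc N" using assms by (cases n) auto
  define t :: "nat \<Rightarrow> nat \<Rightarrow> int fps" where
    "t l r = (- 1) ^ (r - 1) * fps_X ^ (r * (r - 1) div 2 + l * r) * (1 - fps_X ^ r)" for l r
  have C_t: "crank_part n' l = (\<Sum>r=1..n'. t (nat \<bar>l\<bar>) r * qpoch_inv (n' - r) * qpoch_inv (n' + r))" for n' l
    by (simp add: crank_part_def t_def)
  have nats: "nat \<bar>m\<bar> = Suc a" "nat \<bar>m - 1\<bar> = a" "nat \<bar>m + 1\<bar> = Suc (Suc a)"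
    using m by auto
  have step: "t (Suc a) r = fps_X ^ r * t a r" for a r
    by (simp add: t_def power_add)
  have termwise: "(1 + fps_X ^ (2 * n)) * (t (Suc a) r * qpoch_inv (n - r) * qpoch_inv (n + r))
      - fps_X ^ n * (t a r * qpoch_inv (n - r) * qpoch_inv (n + r) + t (Suc (Suc a)) r * qpoch_inv (n - r) * qpoch_inv (n + r))
    = t (Suc a) r * (((1 - fps_X ^ (n - r)) * qpoch_inv (n - r)) * ((1 - fps_X ^ (n + r)) * qpoch_inv (n + r)))"
    if "r \<in> {1..n}" for r
  proof -
    obtain d where d: "n = r + d" using \<open>r \<in> {1..n}\<close> by (metis atLeastAtMost_iff le_iff_add)
    show ?thesis unfolding step d by (simp add: power_add mult_2 mult_2_right algebra_simps)
  qed
  have "(1 + fps_X ^ (2 * n)) * crank_part n m - fps_X ^ n * (crank_part n (m - 1) + crank_part n (m + 1))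
    = (\<Sum>r=1..n. t (Suc a) r * (((1 - fps_X ^ (n - r)) * qpoch_inv (n - r)) * ((1 - fps_X ^ (n + r)) * qpoch_inv (n + r))))"
    unfolding C_t nats sum_distrib_left sum.distrib[symmetric] sum_subtractf[symmetric]
    by (rule sum.cong[OF refl]) (rule termwise)
  also have "\<dots> = (\<Sum>r=1..N. t (Suc a) r * qpoch_inv (N - r) * qpoch_inv (N + r))"
    unfolding n by (simp add: Suc_diff_le one_minus_mult_qpoch_inv del: power_Suc) (simp add: mult.assoc)
  also have "\<dots> = crank_part (n - 1) m" by (simp add: C_t nats n)
  finally show ?thesis .
qed

text \<open>
  For \<open>m = 0\<close> the absolute value in the exponent breaks the termwise argument; the resulting error
  is the sum below with \<open>R = n\<close>, whose partial sums have a closed form that vanishes at \<open>R = n\<close>.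
\<close>
lemma crank_part_telescope:
  assumes "R \<le> n" "n \<ge> 1"
  shows "(1 - fps_X ^ (n - 1)) * (\<Sum>r=1..R. (- 1) ^ (r - 1) * fps_X ^ (r * (r - 1) div 2 + (n - r))
     * (1 - fps_X ^ r) * (1 - fps_X ^ (2 * r)) * qpoch_inv (n - r) * qpoch_inv (n + r))
    = - ((- 1) ^ R * fps_X ^ (R * (R - 1) div 2 + (n - 1)) * (1 - fps_X ^ R) * (1 - fps_X ^ (R + 1))
       * ((1 - fps_X ^ (n - R)) * qpoch_inv (n - R)) * qpoch_inv (n + R))"
  using assms
proof (induction R)
  case (Suc R)
  obtain d where d: "n = Suc R + d" using Suc.prems by (metis le_iff_add)
  have T: "Suc R * (Suc R - 1) div 2 = R * (R - 1) div 2 + R"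
  proof -
    have "Suc R * R = R * (R - 1) + 2 * R" by (cases R) auto
    then show ?thesis by (simp del: mult_Suc)
  qed
  have s: "n - R = Suc d" "n + Suc R = Suc (n + R)" "n - Suc R = d" "n - 1 = R + d" using d by auto
  have p1: "(1 - fps_X ^ Suc d) * qpoch_inv (Suc d) = qpoch_inv d" by (metis qpoch_inv_mult_one_minus mult.commute)
  have p2: "qpoch_inv (n + R) = qpoch_inv (Suc (n + R)) * (1 - fps_X ^ Suc (n + R))" by (simp only: qpoch_inv_mult_one_minus)
  define e where "e = R * (R - 1) div 2"
  show ?case
    using Suc.IH Suc.prems
    unfolding sum.atLeast_Suc_atMost_Suc_shift sum.cl_ivl_Suc T s p1 p2 e_def[symmetric]
    apply (simp add: distrib_left del: power_Suc)
    apply (simp add: d power_add algebra_simps mult_2 mult_2_right)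
    done
qed simp

lemma crank_part_rec_0:
  assumes "n \<ge> 2"
  shows "(1 + fps_X ^ (2 * n)) * crank_part n 0 - fps_X ^ n * (crank_part n (- 1) + crank_part n 1) = crank_part (n - 1) 0"
proof -
  obtain N where n: "n = Suc N" using assms by (cases n) auto
  define t :: "nat \<Rightarrow> int fps" where
    "t r = (- 1) ^ (r - 1) * fps_X ^ (r * (r - 1) div 2) * (1 - fps_X ^ r)" for r
  define w where "w r = (- 1) ^ (r - 1) * fps_X ^ (r * (r - 1) div 2 + (n - r))
     * (1 - fps_X ^ r) * (1 - fps_X ^ (2 * r)) * qpoch_inv (n - r) * qpoch_inv (n + r)" for r
  have C0: "crank_part n' 0 = (\<Sum>r=1..n'. t r * qpoch_inv (n' - r) * qpoch_inv (n' + r))" for n'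
    by (simp add: crank_part_def t_def)
  have C1: "crank_part n' 1 = (\<Sum>r=1..n'. fps_X ^ r * (t r * qpoch_inv (n' - r) * qpoch_inv (n' + r)))" for n'
    by (simp add: crank_part_def t_def power_add mult_ac)
  have termwise: "(1 + fps_X ^ (2 * n)) * (t r * qpoch_inv (n - r) * qpoch_inv (n + r))
      - fps_X ^ n * (fps_X ^ r * (t r * qpoch_inv (n - r) * qpoch_inv (n + r)) + fps_X ^ r * (t r * qpoch_inv (n - r) * qpoch_inv (n + r)))
    = t r * (((1 - fps_X ^ (n - r)) * qpoch_inv (n - r)) * ((1 - fps_X ^ (n + r)) * qpoch_inv (n + r))) + w r"
    if "r \<in> {1..n}" for r
  proof -
    obtain d where d: "n = r + d" using \<open>r \<in> {1..n}\<close> by (metis atLeastAtMost_iff le_iff_add)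
    have w: "w r = t r * fps_X ^ d * (1 - fps_X ^ (2 * r)) * qpoch_inv (n - r) * qpoch_inv (n + r)"
      by (simp add: w_def t_def d power_add mult_ac)
    have ring: "(1 + (x * y) * (x * y)) * (c * a * b) - x * y * (x * (c * a * b) + x * (c * a * b))
      = c * (((1 - y) * a) * ((1 - x * (x * y)) * b)) + c * y * (1 - x * x) * a * b"
      for x y c a b :: "int fps" by algebra
    have X: "fps_X ^ (2 * n) = (fps_X ^ r * fps_X ^ d) * (fps_X ^ r * fps_X ^ d :: int fps)"
      "fps_X ^ n = fps_X ^ r * (fps_X ^ d :: int fps)" "fps_X ^ (n - r) = (fps_X ^ d :: int fps)"
      "fps_X ^ (n + r) = fps_X ^ r * (fps_X ^ r * fps_X ^ d :: int fps)"
      "fps_X ^ (2 * r) = fps_X ^ r * (fps_X ^ r :: int fps)"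
      by (simp_all add: d power_add mult_2 mult_2_right mult_ac)
    show ?thesis unfolding w X by (rule ring)
  qed
  have "(1 - fps_X ^ (n - 1)) * (\<Sum>r=1..n. w r) = 0"
    using crank_part_telescope[of n n] assms unfolding w_def by (simp del: power_Suc)
  then have w0: "(\<Sum>r=1..n. w r) = 0"
    using one_minus_X_power_nonzero[of "n - 1"] assms by simp
  have "(1 + fps_X ^ (2 * n)) * crank_part n 0 - fps_X ^ n * (crank_part n (- 1) + crank_part n 1)
    = (\<Sum>r=1..n. t r * (((1 - fps_X ^ (n - r)) * qpoch_inv (n - r)) * ((1 - fps_X ^ (n + r)) * qpoch_inv (n + r))) + w r)"
    unfolding crank_part_uminus C0 C1 sum_distrib_left sum.distrib[symmetric] sum_subtractf[symmetric]
    by (rule sum.cong[OF refl]) (rule termwise)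
  also have "\<dots> = (\<Sum>r=1..n. t r * (((1 - fps_X ^ (n - r)) * qpoch_inv (n - r)) * ((1 - fps_X ^ (n + r)) * qpoch_inv (n + r))))"
    unfolding sum.distrib w0 by simp
  also have "\<dots> = (\<Sum>r=1..N. t r * qpoch_inv (N - r) * qpoch_inv (N + r))"
    unfolding n by (simp add: Suc_diff_le one_minus_mult_qpoch_inv del: power_Suc) (simp add: mult.assoc)
  also have "\<dots> = crank_part (n - 1) 0" by (simp add: C0 n)
  finally show ?thesis .
qed

lemma crank_part_rec:
  assumes "n \<ge> 2"
  shows "(1 + fps_X ^ (2 * n)) * crank_part n m - fps_X ^ n * (crank_part n (m - 1) + crank_part n (m + 1)) = crank_part (n - 1) m"
proof -
  consider "m \<ge> 1" | "m = 0" | "- m \<ge> 1" by linarith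
  then show ?thesis
  proof cases
    case 1
    then show ?thesis using crank_part_rec_pos assms by simp
  next
    case 2
    then show ?thesis using crank_part_rec_0[OF assms] by simp
  next
    case 3
    have neg: "- m - 1 = - (m + 1)" "- m + 1 = - (m - 1)" by simp_all
    have "crank_part n (- m - 1) = crank_part n (m + 1)" "crank_part n (- m + 1) = crank_part n (m - 1)"
      unfolding neg crank_part_uminus by simp_all
    then show ?thesis using crank_part_rec_pos[of n "- m"] assms 3 by (simp add: crank_part_uminus add.commute)
  qed
qed

section \<open>Solving the recurrence\<close>

lemma shift_recurrence_solution:
  fixes f g :: "int \<Rightarrow> int fps"
  assumes "n \<ge> 1" and rec: "\<And>m. f m = g m + fps_X ^ n * f (m + s)"
  shows "fps_nth (f m) N = (\<Sum>x\<in>{x. n * x \<le> N}. fps_nth (g (m + s * int x)) (N - n * x))"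
proof (induction N arbitrary: m rule: less_induct)
  case (less N)
  have x_le: "x \<le> n * x" for x using assms(1) by simp
  show ?case
  proof (cases "N < n")
    case True
    have "x = 0" if "n * x \<le> N" for x
      using that True by (cases x) auto
    then have "{x. n * x \<le> N} = {0}" by auto
    then show ?thesis using True by (subst rec) (simp add: fps_X_power_mult_nth)
  next
    case False
    have fin: "finite {x. n * x \<le> N'}" for N'
      by (rule finite_subset[of _ "{..N'}"]) (auto intro: le_trans[OF x_le])
    have eq: "{x. n * x \<le> N} = insert 0 (Suc ` {x. n * x \<le> N - n})"
    proof (intro set_eqI iffI)
      fix x assume "x \<in> {x. n * x \<le> N}"
      then show "x \<in> insert 0 (Suc ` {x. n * x \<le> N - n})"
        by (cases x) auto
    next
      fix x assume "x \<in> insert 0 (Suc ` {x. n * x \<le> N - n})"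
      then show "x \<in> {x. n * x \<le> N}" using False by auto
    qed
    have "fps_nth (f m) N = fps_nth (g m) N + fps_nth (f (m + s)) (N - n)"
      using False by (subst rec) (simp add: fps_X_power_mult_nth)
    also have "fps_nth (f (m + s)) (N - n) = (\<Sum>x\<in>{x. n * x \<le> N - n}. fps_nth (g (m + s + s * int x)) (N - n - n * x))"
      using False assms(1) by (intro less) auto
    also have "\<dots> = (\<Sum>x\<in>Suc ` {x. n * x \<le> N - n}. fps_nth (g (m + s * int x)) (N - n * x))"
      by (subst sum.reindex) (auto simp: algebra_simps)
    finally show ?thesis unfolding eq by (subst sum.insert) (auto simp: fin)
  qed
qed

text \<open>
  The second-order recurrence factors into two first-order ones, corresponding to the factors
  $1-zq^n$ and $1-q^n/z$. The pair \<open>(x, y)\<close> records how often the part \<open>n\<close> occurs on either side.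
\<close>
lemma crank_recurrence_solution:
  fixes F G :: "int \<Rightarrow> int fps"
  assumes n: "n \<ge> 1"
    and rec: "\<And>m. (1 + fps_X ^ (2 * n)) * F m - fps_X ^ n * (F (m - 1) + F (m + 1)) = G m"
  shows "fps_nth (F m) N = (\<Sum>(x, y)\<in>{(x, y). n * (x + y) \<le> N}. fps_nth (G (m + int x - int y)) (N - n * (x + y)))"
proof -
  define B where "B m = F m - fps_X ^ n * F (m + 1)" for m
  have x_le: "x \<le> n * x" for x using n by simp
  have fin: "finite {x. n * x \<le> N'}" for N'
    by (rule finite_subset[of _ "{..N'}"]) (auto intro: le_trans[OF x_le])
  have B: "B m = G m + fps_X ^ n * B (m + (- 1))" for m
  proof -
    have ring: "a - x * c = ((1 + x * x) * a - x * (b + c)) + x * (b - x * a)" for a b c x :: "int fps"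
      by algebra
    show ?thesis
      using ring[of "F m" "fps_X ^ n" "F (m + 1)" "F (m - 1)"] rec[of m, symmetric]
      by (simp add: B_def mult_2 power_add)
  qed
  have "fps_nth (F m) N = (\<Sum>x\<in>{x. n * x \<le> N}. fps_nth (B (m + 1 * int x)) (N - n * x))"
    by (rule shift_recurrence_solution[OF n]) (simp add: B_def)
  also have "\<dots> = (\<Sum>x\<in>{x. n * x \<le> N}. \<Sum>y\<in>{y. n * y \<le> N - n * x}.
      fps_nth (G (m + 1 * int x + - 1 * int y)) (N - n * x - n * y))"
    by (intro sum.cong refl shift_recurrence_solution[OF n] B)
  also have "\<dots> = (\<Sum>(x, y)\<in>Sigma {x. n * x \<le> N} (\<lambda>x. {y. n * y \<le> N - n * x}).
      fps_nth (G (m + 1 * int x + - 1 * int y)) (N - n * x - n * y))"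
    by (rule sum.Sigma) (auto simp: fin)
  also have "\<dots> = (\<Sum>(x, y)\<in>{(x, y). n * (x + y) \<le> N}. fps_nth (G (m + int x - int y)) (N - n * (x + y)))"
  proof (rule sum.cong)
    show "Sigma {x. n * x \<le> N} (\<lambda>x. {y. n * y \<le> N - n * x}) = {(x, y). n * (x + y) \<le> N}"
      by (auto simp: algebra_simps)
  qed (auto simp: algebra_simps)
  finally show ?thesis .
qed

lemma finite_pairs: "n \<ge> 1 \<Longrightarrow> finite {(x, y). n * (x + y) \<le> (N :: nat)}"
proof (rule finite_subset[of _ "{..N} \<times> {..N}"])
  assume "n \<ge> 1"
  then have le: "x + y \<le> n * (x + y)" for x y by simp
  have "x \<le> N \<and> y \<le> N" if "n * (x + y) \<le> N" for x y
    using le_trans[OF le that] by simp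
  then show "{(x, y). n * (x + y) \<le> N} \<subseteq> {..N} \<times> {..N}"
    by blast
qed simp

section \<open>Coefficientwise nonnegativity\<close>

text \<open>
  The cone of power series with nonnegative coefficients; it is closed under sums and products.
\<close>
definition nonneg :: "int fps \<Rightarrow> bool" where
  "nonneg f \<longleftrightarrow> (\<forall>n. 0 \<le> fps_nth f n)"

lemma nonneg_D: "nonneg f \<Longrightarrow> 0 \<le> fps_nth f n"
  by (simp add: nonneg_def)

lemma nonneg_simps [simp]: "nonneg 0" "nonneg 1" "nonneg (fps_X ^ n)" "nonneg fps_X" "nonneg (geom n)"
  by (simp_all add: nonneg_def geom_def fps_X_power_nth)

lemma nonneg_add [intro]: "nonneg f \<Longrightarrow> nonneg g \<Longrightarrow> nonneg (f + g)"
  by (simp add: nonneg_def)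

lemma nonneg_mult [intro]: "nonneg f \<Longrightarrow> nonneg g \<Longrightarrow> nonneg (f * g)"
  by (auto simp: nonneg_def fps_mult_nth intro!: sum_nonneg mult_nonneg_nonneg)

lemma nonneg_sum: "(\<And>x. x \<in> A \<Longrightarrow> nonneg (f x)) \<Longrightarrow> nonneg (sum f A)"
  by (induction A rule: infinite_finite_induct) auto

lemma nonneg_qpoch_inv [simp]: "nonneg (qpoch_inv n)"
  by (induction n) (auto simp: qpoch_inv_Suc)

lemma nonneg_qpoch_inv_diff: "n \<ge> 1 \<Longrightarrow> nonneg ((1 - fps_X) * qpoch_inv n)"
proof (induction n rule: nat_induct_at_least)
  case base
  show ?case using one_minus_mult_qpoch_inv[of 0] by simp
next
  case (Suc n)
  then show ?case by (auto simp: qpoch_inv_Suc simp flip: mult.assoc)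
qed

lemma crank_part_1: "crank_part 1 m = fps_X ^ nat \<bar>m\<bar> * geom 2"
proof -
  have "(1 - fps_X) * qpoch_inv 2 = geom 2"
    using geom_mult[of 1] by (simp add: numeral_2_eq_2 qpoch_inv_Suc mult_ac)
  then show ?thesis by (simp add: crank_part_def mult.assoc numeral_2_eq_2)
qed

lemma nonneg_crank_part: "n \<ge> 1 \<Longrightarrow> nonneg (crank_part n m)"
proof (induction n arbitrary: m rule: nat_induct_at_least)
  case base
  show ?case by (auto simp: crank_part_1 simp del: One_nat_def)
next
  case (Suc n)
  have "fps_nth (crank_part (Suc n) m) N = (\<Sum>(x, y)\<in>{(x, y). Suc n * (x + y) \<le> N}.
      fps_nth (crank_part n (m + int x - int y)) (N - Suc n * (x + y)))" for N
    using crank_part_rec[of "Suc n"] Suc.hyps by (intro crank_recurrence_solution) auto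
  then show ?case
    using Suc.IH by (auto simp: nonneg_def intro!: sum_nonneg)
qed

text \<open>
  Equivalently $q^m/((1-q^2)(1-q^3)) - q^{2m+1}/((1-q^3)(1-q^4))$ for \<open>m \<ge> 0\<close>, written over the
  common denominator $(1-q^3)(1-q^4)$.
\<close>
lemma crank_part_2_diff: "(1 - fps_X) * crank_part 2 m = fps_X ^ nat \<bar>m\<bar> *
   (geom 3 * geom 4 + fps_X ^ 2 * (geom 3 * geom 4) - fps_X ^ (nat \<bar>m\<bar> + 1) * (geom 3 * geom 4))"
proof -
  define x where "x = (fps_X :: int fps)"
  define M where "M = x ^ nat \<bar>m\<bar>"
  have g1: "geom 1 * (1 - x) = 1" and g2: "geom 2 * (1 - x ^ 2) = 1" and g4: "geom 4 * (1 - x ^ 4) = 1"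
    using geom_mult[of 1] geom_mult[of 2] geom_mult[of 4] by (simp_all add: x_def)
  have g24: "geom 2 = geom 4 * (1 + x ^ 2)"
  proof -
    have "(1 - x ^ 2) * geom 2 = (1 - x ^ 2) * (geom 4 * (1 + x ^ 2))"
      using g2 g4 by algebra
    moreover have "1 - x ^ 2 \<noteq> 0" using g2 by (metis mult_zero_right zero_neq_one)
    ultimately show ?thesis by (metis mult_left_cancel)
  qed
  have PP: "qpoch_inv 1 = geom 1" "qpoch_inv 3 = geom 1 * geom 2 * geom 3" "qpoch_inv 4 = geom 1 * geom 2 * geom 3 * geom 4"
    by (simp_all add: qpoch_inv_Suc numeral_2_eq_2 numeral_3_eq_3 numeral_eq_Suc)
  have "crank_part 2 m = M * (1 - x) * qpoch_inv 1 * qpoch_inv 3 - x * M ^ 2 * (1 - x ^ 2) * qpoch_inv 4"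
    by (simp add: crank_part_def numeral_2_eq_2 M_def x_def numeral_3_eq_3 eval_nat_numeral power_add mult_ac)
  then have "(1 - x) * crank_part 2 m = (geom 1 * (1 - x)) * (geom 1 * (1 - x)) * M * geom 2 * geom 3
     - x * M ^ 2 * (geom 2 * (1 - x ^ 2)) * (geom 1 * (1 - x)) * geom 3 * geom 4"
    unfolding PP by (simp only: power2_eq_square mult_ac left_diff_distrib right_diff_distrib)
  also have "\<dots> = M * geom 2 * geom 3 - x * M ^ 2 * geom 3 * geom 4"
    by (simp only: g1 g2) simp
  also have "\<dots> = M * (geom 3 * geom 4 + x ^ 2 * (geom 3 * geom 4) - (M * x) * (geom 3 * geom 4))"
    unfolding g24 by algebra
  finally show ?thesis by (simp add: x_def M_def mult_ac)
qed

section \<open>First differences of the crank parts\<close>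

text \<open>
  Coefficients at an integer index, zero at negative ones, so that multiplication by a power of
  \<open>fps_X\<close> is an unrestricted index shift.
\<close>
definition int_nth :: "int fps \<Rightarrow> int \<Rightarrow> int" where
  "int_nth f i = (if i < 0 then 0 else fps_nth f (nat i))"

lemma int_nth_int: "int_nth f (int n) = fps_nth f n"
  by (simp add: int_nth_def)

lemma int_nth_X_mult: "int_nth (fps_X ^ n * f) i = int_nth f (i - int n)"
  by (auto simp: int_nth_def fps_X_power_mult_nth nat_diff_distrib nat_less_iff zless_nat_eq_int_zless)

lemma int_nth_add: "int_nth (f + g) i = int_nth f i + int_nth g i" and int_nth_diff: "int_nth (f - g) i = int_nth f i - int_nth g i"
  by (simp_all add: int_nth_def)

lemma int_nth_geom: "n \<ge> 1 \<Longrightarrow> int_nth (geom n) i = (if 0 \<le> i \<and> int n dvd i then 1 else 0)"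
  by (cases i rule: int_cases) (auto simp: int_nth_int geom_def, auto simp: int_nth_def)

lemma int_nth_geom_mult: 
  assumes "n \<ge> 1"
  shows "int_nth (f * geom n) i = int_nth (f * geom n) (i - int n) + int_nth f i"
proof -
  have "f * geom n = fps_X ^ n * (f * geom n) + f * (geom n * (1 - fps_X ^ n))"
    by algebra
  then have "f * geom n = fps_X ^ n * (f * geom n) + f"
    using geom_mult[OF assms] by simp
  then show ?thesis by (metis int_nth_add int_nth_X_mult)
qed

text \<open>
  The coefficients \<open>\<rho> i\<close> count the partitions of \<open>i\<close> into parts 3 and 4.
\<close>
lemma parts_3_4:
  defines "\<rho> \<equiv> int_nth (geom 3 * geom 4)"
  shows "\<rho> i = \<rho> (i - 3) + (if 0 \<le> i \<and> 4 dvd i then 1 else 0)"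
    "\<rho> i = \<rho> (i - 4) + (if 0 \<le> i \<and> 3 dvd i then 1 else 0)"
    "\<rho> (i - 3) \<le> \<rho> i" "\<rho> (i - 4) \<le> \<rho> i" "0 \<le> \<rho> i" "i < 0 \<Longrightarrow> \<rho> i = 0"
proof -
  show 1: "\<rho> i = \<rho> (i - 3) + (if 0 \<le> i \<and> 4 dvd i then 1 else 0)"
    using int_nth_geom_mult[of 3 "geom 4" i] int_nth_geom[of 4 i] by (simp add: \<rho>_def mult.commute)
  show 2: "\<rho> i = \<rho> (i - 4) + (if 0 \<le> i \<and> 3 dvd i then 1 else 0)"
    using int_nth_geom_mult[of 4 "geom 3" i] int_nth_geom[of 3 i] by (simp add: \<rho>_def)
  show "\<rho> (i - 3) \<le> \<rho> i" "\<rho> (i - 4) \<le> \<rho> i" using 1 by simp (use 2 in simp)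
  show "0 \<le> \<rho> i" by (auto simp: \<rho>_def int_nth_def intro!: nonneg_D)
  show "i < 0 \<Longrightarrow> \<rho> i = 0" by (simp add: \<rho>_def int_nth_def)
qed

text \<open>
  The excluded shifts are exactly the positive integers that are not of the form \<open>3 * a + 4 * b\<close>.
\<close>
lemma parts_3_4_mono: "s \<notin> {1, 2, 5} \<Longrightarrow> int_nth (geom 3 * geom 4) (i - int s) \<le> int_nth (geom 3 * geom 4) i"
proof (induction s arbitrary: i rule: less_induct)
  case (less s)
  consider "s = 0" | "s = 4" | "s = 8" | "s \<ge> 3" "s \<noteq> 4" "s \<noteq> 8" using less.prems by force
  then show ?case
  proof cases
    case 3
    then show ?thesis using parts_3_4(4)[of i] parts_3_4(4)[of "i - 4"] by simp
  next
    case 4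
    then have "s - 3 \<notin> {1, 2, 5}" using less.prems by auto
    then have "int_nth (geom 3 * geom 4) (i - 3 - int (s - 3)) \<le> int_nth (geom 3 * geom 4) (i - 3)"
      using 4 by (intro less.IH) auto
    also have "\<dots> \<le> int_nth (geom 3 * geom 4) i" by (rule parts_3_4)
    finally show ?thesis using 4 by (simp add: of_nat_diff)
  qed (use parts_3_4(4)[of i] in auto)
qed

lemma parts_3_4_pred: 
  assumes "i \<noteq> 1"
  shows "int_nth (geom 3 * geom 4) (i - 1) \<le> int_nth (geom 3 * geom 4) i + int_nth (geom 3 * geom 4) (i - 2)"
proof -
  let ?r = "int_nth (geom 3 * geom 4)"
  consider "\<not> (0 \<le> i - 1 \<and> 4 dvd i - 1)" | "\<not> 3 dvd i - 1" | "0 \<le> i - 1" "4 dvd i - 1" "3 dvd i - 1" by blast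
  then show ?thesis
  proof cases
    case 1
    then have "?r (i - 1) = ?r (i - 4)" using parts_3_4(1)[of "i - 1"] by simp
    then show ?thesis using parts_3_4(4)[of i] parts_3_4(5)[of "i - 2"] by simp
  next
    case 2
    then have "?r (i - 1) = ?r (i - 5)" using parts_3_4(2)[of "i - 1"] by simp
    then show ?thesis using parts_3_4(3)[of "i - 2"] parts_3_4(5)[of i] by simp
  next
    case 3
    then have "i - 9 \<ge> 0" "4 dvd i - 9" using assms by presburger+
    then have "?r (i - 9) \<ge> 1" using parts_3_4(1)[of "i - 9"] parts_3_4(5)[of "i - 12"] by simp
    moreover have "?r (i - 9) \<le> ?r i" using parts_3_4_mono[of 9 i] by simp
    moreover have "?r (i - 1) \<le> ?r (i - 5) + 1" using parts_3_4(2)[of "i - 1"] by simp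
    ultimately show ?thesis using parts_3_4(3)[of "i - 2"] by simp
  qed
qed

text \<open>
  Coefficients of \<open>1 - fps_X\<close> times a crank part, that is, first differences of its coefficients.
\<close>
definition crank_diff :: "nat \<Rightarrow> int \<Rightarrow> nat \<Rightarrow> int" where
  "crank_diff n m N = fps_nth ((1 - fps_X) * crank_part n m) N"

lemma crank_diff_2: "crank_diff 2 m N = (let i = int N - \<bar>m\<bar>; r = int_nth (geom 3 * geom 4) in
   r i + r (i - 2) - r (i - \<bar>m\<bar> - 1))"
  unfolding crank_diff_def int_nth_int[symmetric] crank_part_2_diff int_nth_X_mult int_nth_add int_nth_diff by (simp add: Let_def algebra_simps)

lemma crank_diff_2_nonneg:
  assumes "(m, N) \<noteq> (0, 1)"
  shows "0 \<le> crank_diff 2 m N"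
proof -
  let ?r = "int_nth (geom 3 * geom 4)"
  define i where "i = int N - \<bar>m\<bar>"
  define s where "s = nat \<bar>m\<bar> + 1"
  have s: "i - \<bar>m\<bar> - 1 = i - int s" by (simp add: s_def)
  have "?r (i - int s) \<le> ?r i + ?r (i - 2)"
  proof -
    consider "s = 1" | "s = 2" | "s = 5" | "s \<notin> {1, 2, 5}" by blast
    then show ?thesis
    proof cases
      case 1
      then have "i \<noteq> 1" using assms by (auto simp: s_def i_def)
      then show ?thesis using parts_3_4_pred 1 by simp
    next
      case 2 then show ?thesis using parts_3_4(5)[of i] by simp
    next
      case 3 then show ?thesis using parts_3_4(3)[of "i - 2"] parts_3_4(5)[of i] by simp
    next
      case 4 then show ?thesis using parts_3_4_mono[OF 4, of i] parts_3_4(5)[of "i - 2"] by simp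
    qed
  qed
  then show ?thesis by (simp add: crank_diff_2 Let_def s flip: i_def)
qed

lemma crank_diff_conv:
  assumes "n \<ge> 2"
  shows "crank_diff n m N = (\<Sum>(x, y)\<in>{(x, y). n * (x + y) \<le> N}. crank_diff (n - 1) (m + int x - int y) (N - n * (x + y)))"
  unfolding crank_diff_def
proof (rule crank_recurrence_solution[where F = "\<lambda>m. (1 - fps_X) * crank_part n m" and G = "\<lambda>m. (1 - fps_X) * crank_part (n - 1) m"])
  fix m :: int
  have ring: "(1 + u) * (y * a) - v * (y * b + y * c) = y * ((1 + u) * a - v * (b + c))"
    for u v y a b c :: "int fps" by (simp add: algebra_simps)
  show "(1 + fps_X ^ (2 * n)) * ((1 - fps_X) * crank_part n m) -
         fps_X ^ n * ((1 - fps_X) * crank_part n (m - 1) + (1 - fps_X) * crank_part n (m + 1)) =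
         (1 - fps_X) * crank_part (n - 1) m"
    unfolding ring crank_part_rec[OF assms] by (rule refl)
qed (use assms in auto)

lemma crank_diff_uminus: "crank_diff n (- m) N = crank_diff n m N"
  by (simp add: crank_diff_def crank_part_uminus)

text \<open>
  From \<open>n = 2\<close> on, the only negative first difference is the one at \<open>(m, N) = (0, 1)\<close>. In the
  inductive step the convolution has at most one negative summand, at a pair \<open>(x, y)\<close> with
  \<open>y - x = m\<close>; removing one copy of the part \<open>Suc n\<close> from one side leads to a pair whose summand
  is \<open>crank_diff n 1 (n + 2) \<ge> 1\<close> or its mirror image, which compensates. The last two
  conjuncts keep this compensator available.
\<close>
lemma crank_diff_bounds:
  assumes "n \<ge> 2"
  shows "(\<forall>m N. (m, N) \<noteq> (0, 1) \<longrightarrow> 0 \<le> crank_diff n m N) \<and> crank_diff n 0 1 \<ge> - 1 \<and> crank_diff n 0 2 \<ge> 1 \<and> crank_diff n 1 (n + 2) \<ge> 1"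
  using assms
proof (induction n rule: nat_induct_at_least)
  case base
  let ?r = "int_nth (geom 3 * geom 4)"
  have neg: "?r (- 4) = 0" "?r (- 3) = 0" "?r (- 2) = 0" "?r (- 1) = 0" by (rule parts_3_4(6), simp)+
  define \<rho> where "\<rho> = ?r"
  have r: "\<rho> 0 = 1" "\<rho> 1 = 0" "\<rho> 2 = 0" "\<rho> 3 = 1"
    using parts_3_4(1)[of 0] parts_3_4(1)[of 1] parts_3_4(1)[of 2] parts_3_4(2)[of 3] neg
    unfolding \<rho>_def[symmetric] by simp_all
  have "crank_diff 2 0 1 = - 1" "crank_diff 2 0 2 = 1" "crank_diff 2 1 4 = 1"
    using crank_diff_2[of 0 1] crank_diff_2[of 0 2] crank_diff_2[of 1 4] r neg
    unfolding \<rho>_def[symmetric] Let_def by simp_all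
  then show ?case using crank_diff_2_nonneg by simp
next
  case (Suc n)
  have nonneg: "0 \<le> crank_diff n m N" if "(m, N) \<noteq> (0, 1)" for m N using Suc.IH that by blast
  have low: "- 1 \<le> crank_diff n 0 1" and d02: "1 \<le> crank_diff n 0 2" and d1: "crank_diff n 1 (n + 2) \<ge> 1" using Suc.IH by blast+
  define k where "k = Suc n"
  have k: "k \<ge> 3" using Suc.hyps by (simp add: k_def)
  define S where "S N = {(x, y). k * (x + y) \<le> N}" for N
  define t where "t m N = (\<lambda>(x, y). crank_diff n (m + int x - int y) (N - k * (x + y)))" for m N
  have conv: "crank_diff k m N = sum (t m N) (S N)" for m N
    using crank_diff_conv[of k m N] k by (simp add: S_def t_def k_def del: mult_Suc)
  have fin: "finite (S N)" for N unfolding S_def by (rule finite_pairs) (use k in simp)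
  have small: "crank_diff k m N = crank_diff n m N" if "N < k" for m N
  proof -
    have "x = 0 \<and> y = 0" if "k * (x + y) \<le> N" for x y
      using that \<open>N < k\<close> by (cases "x + y") auto
    then have "S N = {(0, 0)}" unfolding S_def by auto
    then show ?thesis by (simp add: conv t_def)
  qed
  have pos: "0 \<le> crank_diff k m N" if mN: "(m, N) \<noteq> (0, 1)" and m: "m \<ge> 0" for m N
  proof (cases "\<exists>p\<in>S N. t m N p < 0")
    case False
    then show ?thesis unfolding conv by (intro sum_nonneg) (auto simp: not_less)
  next
    case True
    then obtain x y where xy: "(x, y) \<in> S N" "t m N (x, y) < 0" by auto
    have key: "int y = m + int x \<and> N = k * (x + y) + 1" if xy: "(x, y) \<in> S N" "t m N (x, y) < 0" for x y
    proof -
      have "(m + int x - int y, N - k * (x + y)) = (0, 1)"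
        using xy(2) nonneg[of "m + int x - int y" "N - k * (x + y)"] unfolding t_def by fastforce
      then have "m + int x - int y = 0" "N - k * (x + y) = 1" by simp_all
      then show ?thesis by linarith
    qed
    have y: "int y = m + int x" and N: "N = k * (x + y) + 1" using key[OF xy] by blast+
    have "y \<ge> 1"
    proof (rule ccontr)
      assume "\<not> y \<ge> 1"
      then have "m = 0" "x = 0" "y = 0" using y m by linarith+
      then show False using N mN by simp
    qed
    \<comment> \<open>Drop one copy of the part \<open>k\<close>: the size left over grows from 1 to \<open>n + 2\<close>.\<close>
    define q where "q = (if x \<ge> 1 then (x - 1, y) else (x, y - 1))"
    have q: "q \<in> S N" "q \<noteq> (x, y)" "t m N q \<ge> 1"
    proof -
      obtain a b where ab: "q = (a, b)" by force
      have sum: "x + y = Suc (a + b)"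
        using \<open>y \<ge> 1\<close> ab by (cases "x \<ge> 1") (auto simp: q_def)
      have N': "N = k * (a + b) + (n + 2)" unfolding N sum by (simp add: k_def)
      show "q \<in> S N" unfolding ab S_def using N' by simp
      show "q \<noteq> (x, y)" using sum ab by auto
      have "m + int a - int b = - 1 \<or> m + int a - int b = 1"
        using y \<open>y \<ge> 1\<close> ab by (cases "x \<ge> 1") (auto simp: q_def of_nat_diff)
      then have "crank_diff n (m + int a - int b) (n + 2) \<ge> 1"
        using d1 crank_diff_uminus[of n 1] by (elim disjE) (simp_all only:)
      moreover have "N - k * (a + b) = n + 2" using N' by simp
      ultimately show "t m N q \<ge> 1" by (simp add: t_def ab)
    qed
    have others: "0 \<le> t m N p" if p: "p \<in> S N - {(x, y)} - {q}" for p
    proof (rule ccontr)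
      assume neg: "\<not> 0 \<le> t m N p"
      obtain a b where ab: "p = (a, b)" by force
      have "int b = m + int a" "N = k * (a + b) + 1" using key[of a b] neg p unfolding ab by simp_all
      moreover from this have "a + b = x + y" using N k by simp
      ultimately have "a = x" "b = y" using y by linarith+
      then show False using p ab by simp
    qed
    have "t m N (x, y) = crank_diff n 0 1" using y N by (simp add: t_def)
    then have "- 1 \<le> t m N (x, y)" using low by simp
    moreover have "sum (t m N) (S N) = t m N (x, y) + sum (t m N) (S N - {(x, y)})"
      using xy(1) fin by (intro sum.remove)
    moreover have "sum (t m N) (S N - {(x, y)}) = t m N q + sum (t m N) (S N - {(x, y)} - {q})"
      using q fin by (intro sum.remove) auto
    moreover have "0 \<le> sum (t m N) (S N - {(x, y)} - {q})" using others by (rule sum_nonneg)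
    ultimately show ?thesis using q(3) unfolding conv by linarith
  qed
  have pos': "0 \<le> crank_diff k m N" if mN: "(m, N) \<noteq> (0, 1)" for m N
  proof (cases "m \<ge> 0")
    case False
    then have "0 \<le> crank_diff k (- m) N" by (intro pos) auto
    then show ?thesis by (simp only: crank_diff_uminus)
  qed (use pos mN in blast)
  have "t 1 (k + 2) (0, 1) \<le> crank_diff k 1 (k + 2)"
    unfolding conv
  proof (rule member_le_sum)
    show "(0, 1) \<in> S (k + 2)" by (simp add: S_def)
    fix p assume "p \<in> S (k + 2) - {(0, 1)}"
    moreover obtain x y where xy: "p = (x, y)" by force
    ultimately have p: "p = (x, y)" "k * (x + y) \<le> k + 2" "(x, y) \<noteq> (0, 1)"
      by (simp_all add: S_def del: Pair_inject prod.inject)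
    have "x + y < 2"
    proof (rule ccontr)
      assume "\<not> x + y < 2"
      then have "k * 2 \<le> k * (x + y)" by (intro mult_le_mono2) simp
      then have "k * 2 \<le> k + 2" using p(2) by (rule le_trans)
      then show False using k by simp
    qed
    then have "1 + int x - int y \<noteq> 0" using p(3) by auto
    then show "0 \<le> t 1 (k + 2) p" using nonneg by (simp add: t_def p(1))
  qed (rule fin)
  moreover have "t 1 (k + 2) (0, 1) = crank_diff n 0 2" by (simp add: t_def)
  ultimately have "crank_diff k 1 (k + 2) \<ge> 1" using d02 by linarith
  moreover have "crank_diff k 0 1 \<ge> - 1" "crank_diff k 0 2 \<ge> 1" using low d02 k by (simp_all only: small)
  ultimately show ?case
    using pos' unfolding k_def by blast
qed

section \<open>The Bailey chain\<close>

text \<open>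
  The limiting case of the q-Vandermonde sum; combinatorially, dissection by a Durfee rectangle.
\<close>
lemma q_vandermonde_limit:
  "(\<Sum>j\<le>M. fps_X ^ (j * (j + s)) * qpoch_inv (M - j) * qpoch_inv j * qpoch_inv (j + s)) = qpoch_inv M * qpoch_inv (M + s)"
proof (induction M arbitrary: s)
  case (Suc M)
  define A where "A j = fps_X ^ (j * (j + s)) * fps_X ^ j
    * ((1 - fps_X ^ (Suc M - j)) * qpoch_inv (Suc M - j)) * qpoch_inv j * qpoch_inv (j + s)" for j
  define B where "B j = fps_X ^ (j * (j + s)) * ((1 - fps_X ^ j) * qpoch_inv j) * qpoch_inv (Suc M - j) * qpoch_inv (j + s)" for j
  define K where "K j = fps_X ^ (j * (j + Suc s)) * qpoch_inv (M - j) * qpoch_inv j * qpoch_inv (j + Suc s)" for j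
  have P_s: "qpoch_inv (j + s) = qpoch_inv (j + Suc s) * (1 - fps_X ^ (j + Suc s))" for j
    using qpoch_inv_mult_one_minus[of "j + s"] by simp
  have A: "A j = K j * (1 - fps_X ^ (j + Suc s))" if "j \<le> M" for j
  proof -
    have "(1 - fps_X ^ (Suc M - j)) * qpoch_inv (Suc M - j) = qpoch_inv (M - j)"
      using that by (simp only: Suc_diff_le one_minus_mult_qpoch_inv)
    then show ?thesis
      unfolding A_def K_def P_s by (simp only: power_add mult_Suc_right add_Suc_right distrib_left mult_ac)
  qed
  have B: "B (Suc j) = K j * fps_X ^ (j + Suc s)" for j
  proof -
    have "Suc j * (Suc j + s) = j * (j + Suc s) + (j + Suc s)" by simp
    then show ?thesis
      unfolding B_def K_def one_minus_mult_qpoch_inv by (simp only: power_add diff_Suc_Suc add_Suc_shift mult_ac)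
  qed
  have split: "(1 - fps_X ^ Suc M) * (fps_X ^ (j * (j + s)) * qpoch_inv (Suc M - j) * qpoch_inv j * qpoch_inv (j + s)) = A j + B j"
    if "j \<le> Suc M" for j
  proof -
    have "fps_X ^ Suc M = fps_X ^ j * (fps_X ^ (Suc M - j) :: int fps)"
      using that by (metis le_add_diff_inverse power_add)
    then show ?thesis unfolding A_def B_def by (simp add: algebra_simps del: power_Suc)
  qed
  have "(1 - fps_X ^ Suc M) * (\<Sum>j\<le>Suc M. fps_X ^ (j * (j + s)) * qpoch_inv (Suc M - j) * qpoch_inv j * qpoch_inv (j + s))
    = (\<Sum>j\<le>Suc M. A j) + (\<Sum>j\<le>Suc M. B j)"
    unfolding sum_distrib_left sum.distrib[symmetric] by (rule sum.cong[OF refl], rule split) simp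
  also have "(\<Sum>j\<le>Suc M. A j) = (\<Sum>j\<le>M. K j * (1 - fps_X ^ (j + Suc s)))"
    by (simp add: A) (simp add: A_def)
  also have "(\<Sum>j\<le>Suc M. B j) = (\<Sum>j\<le>M. K j * fps_X ^ (j + Suc s))"
    by (simp only: sum.atMost_Suc_shift B) (simp add: B_def)
  also have "(\<Sum>j\<le>M. K j * (1 - fps_X ^ (j + Suc s))) + (\<Sum>j\<le>M. K j * fps_X ^ (j + Suc s)) = (\<Sum>j\<le>M. K j)"
    unfolding sum.distrib[symmetric] by (simp add: right_diff_distrib)
  also have "\<dots> = qpoch_inv M * qpoch_inv (M + Suc s)" unfolding K_def by (rule Suc.IH)
  also have "\<dots> = (1 - fps_X ^ Suc M) * (qpoch_inv (Suc M) * qpoch_inv (Suc M + s))"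
    unfolding mult.assoc[symmetric] one_minus_mult_qpoch_inv by simp
  finally show ?case
    using one_minus_X_power_nonzero[of "Suc M"] by (simp del: power_Suc)
qed simp

text \<open>
  The alternating sequence of the Bailey pair; it contains all the dependence on \<open>m\<close>.
\<close>
definition bailey_alpha :: "int \<Rightarrow> nat \<Rightarrow> int fps" where
  "bailey_alpha m r = (- 1) ^ (r - 1) * fps_X ^ (r * (r - 1) div 2 + nat \<bar>m\<bar> * r) * (1 - fps_X ^ r)"

text \<open>
  The iterates of the Bailey transform, starting from the crank parts; \<open>bailey_beta j m N\<close> is a
  \<open>j\<close>-fold sum over indices $N \ge n_1 \ge \dots \ge n_j \ge 1$.
\<close>
fun bailey_beta :: "nat \<Rightarrow> int \<Rightarrow> nat \<Rightarrow> int fps" where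
  "bailey_beta 0 m N = crank_part N m"
| "bailey_beta (Suc j) m N = (\<Sum>i=1..N. fps_X ^ (i * i) * qpoch_inv (N - i) * bailey_beta j m i)"

text \<open>
  Each application of the transform multiplies the \<open>r\<close>-th entry of \<open>bailey_alpha\<close> by $q^{r^2}$.
\<close>
lemma bailey_beta_eq: "bailey_beta j m N = (\<Sum>r=1..N. bailey_alpha m r * fps_X ^ (j * (r * r)) * qpoch_inv (N - r) * qpoch_inv (N + r))"
proof (induction j arbitrary: N)
  case 0
  show ?case by (simp add: crank_part_def bailey_alpha_def)
next
  case (Suc j)
  have inner: "(\<Sum>i\<in>{i \<in> {1..N}. r \<le> i}. fps_X ^ (i * i) * qpoch_inv (N - i) * (bailey_alpha m r * fps_X ^ (j * (r * r)) * qpoch_inv (i - r) * qpoch_inv (i + r)))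
    = bailey_alpha m r * fps_X ^ (Suc j * (r * r)) * qpoch_inv (N - r) * qpoch_inv (N + r)" if r: "r \<in> {1..N}" for r
  proof -
    obtain M where M: "N = r + M" using r by (metis atLeastAtMost_iff le_iff_add)
    have set: "{i \<in> {1..N}. r \<le> i} = (\<lambda>i. r + i) ` {..M}"
    proof (intro set_eqI iffI)
      fix i assume "i \<in> {i \<in> {1..N}. r \<le> i}"
      then show "i \<in> (\<lambda>i. r + i) ` {..M}"
        using M by (intro image_eqI[of _ _ "i - r"]) auto
    qed (use r M in auto)
    have "(\<Sum>i\<in>{i \<in> {1..N}. r \<le> i}. fps_X ^ (i * i) * qpoch_inv (N - i) * (bailey_alpha m r * fps_X ^ (j * (r * r)) * qpoch_inv (i - r) * qpoch_inv (i + r)))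
      = (\<Sum>i\<le>M. bailey_alpha m r * fps_X ^ (Suc j * (r * r)) * (fps_X ^ (i * (i + 2 * r)) * qpoch_inv (M - i) * qpoch_inv i * qpoch_inv (i + 2 * r)))"
      unfolding set
    proof (subst sum.reindex)
      have sq: "(r + i) * (r + i) = r * r + i * (i + 2 * r)" for i by (simp add: algebra_simps)
      have idx: "N - (r + i) = M - i" "r + i - r = i" "r + i + r = i + 2 * r"
        "Suc j * (r * r) = r * r + j * (r * r)" for i
        using M by simp_all
      show "sum ((\<lambda>i. fps_X ^ (i * i) * qpoch_inv (N - i) * (bailey_alpha m r * fps_X ^ (j * (r * r)) * qpoch_inv (i - r) * qpoch_inv (i + r))) \<circ> (+) r) {..M}
        = (\<Sum>i\<le>M. bailey_alpha m r * fps_X ^ (Suc j * (r * r)) * (fps_X ^ (i * (i + 2 * r)) * qpoch_inv (M - i) * qpoch_inv i * qpoch_inv (i + 2 * r)))"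
        unfolding o_def sq idx by (simp only: power_add mult_ac)
    qed simp
    also have "\<dots> = bailey_alpha m r * fps_X ^ (Suc j * (r * r)) * (qpoch_inv M * qpoch_inv (M + 2 * r))"
      by (simp only: sum_distrib_left[symmetric] q_vandermonde_limit)
    finally show ?thesis by (simp add: M mult_2 add_ac mult.assoc)
  qed
  have "bailey_beta (Suc j) m N = (\<Sum>i\<in>{1..N}. \<Sum>r\<in>{r \<in> {1..N}. r \<le> i}.
     fps_X ^ (i * i) * qpoch_inv (N - i) * (bailey_alpha m r * fps_X ^ (j * (r * r)) * qpoch_inv (i - r) * qpoch_inv (i + r)))"
    unfolding bailey_beta.simps Suc.IH sum_distrib_left
    by (intro sum.cong refl) auto
  also have "\<dots> = (\<Sum>r\<in>{1..N}. \<Sum>i\<in>{i \<in> {1..N}. r \<le> i}.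
     fps_X ^ (i * i) * qpoch_inv (N - i) * (bailey_alpha m r * fps_X ^ (j * (r * r)) * qpoch_inv (i - r) * qpoch_inv (i + r)))"
    by (rule sum.swap_restrict) auto
  also have "\<dots> = (\<Sum>r\<in>{1..N}. bailey_alpha m r * fps_X ^ (Suc j * (r * r)) * qpoch_inv (N - r) * qpoch_inv (N + r))"
    by (rule sum.cong[OF refl]) (rule inner)
  finally show ?case .
qed

section \<open>Passage to the k-rank generating function\<close>

text \<open>
  Congruence of power series modulo $q^{n+1}$; it replaces limits in the comparison of the
  truncated identities with the infinite ones.
\<close>
definition eq_upto :: "nat \<Rightarrow> int fps \<Rightarrow> int fps \<Rightarrow> bool" where
  "eq_upto n f g \<longleftrightarrow> (\<forall>i\<le>n. fps_nth f i = fps_nth g i)"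

lemma eq_upto_refl [simp]: "eq_upto n f f" by (simp add: eq_upto_def)

lemma eq_upto_sym: "eq_upto n f g \<Longrightarrow> eq_upto n g f" by (simp add: eq_upto_def)

lemma eq_upto_trans [trans]: "eq_upto n f g \<Longrightarrow> eq_upto n g h \<Longrightarrow> eq_upto n f h"
  by (simp add: eq_upto_def)

lemma eq_upto_mult: "eq_upto n f f' \<Longrightarrow> eq_upto n g g' \<Longrightarrow> eq_upto n (f * g) (f' * g')"
  by (simp add: eq_upto_def fps_mult_nth)

lemma eq_upto_sum: "(\<And>x. x \<in> A \<Longrightarrow> eq_upto n (f x) (g x)) \<Longrightarrow> eq_upto n (sum f A) (sum g A)"
  by (simp add: eq_upto_def fps_sum_nth)

lemma eq_upto_X_mult: "n < k \<Longrightarrow> eq_upto n (fps_X ^ k * f) 0"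
  by (simp add: eq_upto_def fps_X_power_mult_nth)

abbreviation "qpoch_inf_inv \<equiv> fps_right_inverse q_pochhammer_inf 1"

lemma q_pochhammer_inf_mult_inv: "q_pochhammer_inf * qpoch_inf_inv = 1"
  by (rule fps_right_inverse) (simp add: fps_nth_q_pochhammer_inf)

lemma qpoch_inv_prod: "qpoch_inv (Suc M) * (\<Prod>i\<le>M. 1 - fps_X ^ Suc i) = 1"
proof (induction M)
  case 0
  show ?case using qpoch_inv_mult_one_minus[of 0] by simp
next
  case (Suc M)
  have "qpoch_inv (Suc (Suc M)) * (\<Prod>i\<le>Suc M. 1 - fps_X ^ Suc i)
    = (qpoch_inv (Suc (Suc M)) * (1 - fps_X ^ Suc (Suc M))) * (\<Prod>i\<le>M. 1 - fps_X ^ Suc i)"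
    by (simp only: prod.atMost_Suc mult_ac)
  then show ?case unfolding qpoch_inv_mult_one_minus Suc.IH .
qed

lemma eq_upto_q_pochhammer: 
  assumes "n \<le> M"
  shows "eq_upto n q_pochhammer_inf (\<Prod>i\<le>M. 1 - fps_X ^ Suc i)"
proof -
  have "fps_nth (\<Prod>i\<le>M. 1 - fps_X ^ Suc i :: int fps) l = fps_nth (\<Prod>i\<le>l. 1 - fps_X ^ Suc i) l" if "l \<le> M" for l
    using that
  proof (induction M rule: dec_induct)
    case (step M)
    then show ?case
      by (simp add: right_diff_distrib fps_X_power_mult_right_nth del: power_Suc)
  qed simp
  then show ?thesis using assms by (simp add: eq_upto_def fps_nth_q_pochhammer_inf)
qed

lemma eq_upto_qpoch_inv: 
  assumes "n < M"
  shows "eq_upto n (qpoch_inv M) qpoch_inf_inv"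
proof -
  obtain M' where M: "M = Suc M'" using assms by (cases M) auto
  have "eq_upto n (qpoch_inv M * q_pochhammer_inf * qpoch_inf_inv) (qpoch_inv M * (\<Prod>i\<le>M'. 1 - fps_X ^ Suc i) * qpoch_inf_inv)"
    using assms M by (intro eq_upto_mult eq_upto_refl eq_upto_q_pochhammer) auto
  then show ?thesis
    unfolding M qpoch_inv_prod by (simp add: mult.assoc q_pochhammer_inf_mult_inv)
qed

lemma k_rank_term_eq_alpha:
  assumes "k \<ge> 1" "r \<ge> 1"
  shows "k_rank_term k m r = fps_X ^ ((k - 1) * (r * r)) * bailey_alpha m r"
proof -
  define e where "e = r * (r - 1) div 2"
  have "even (r * (r - 1))" by (cases r) auto
  then have "2 * (r * (r - 1) div 2) = r * (r - 1)" by simp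
  then have "2 * int (r * (r - 1) div 2) = int r * (int r - 1)"
    using assms by (metis of_nat_1 of_nat_diff of_nat_mult of_nat_numeral)
  then have e: "2 * int e = int r * (int r - 1)" by (simp only: e_def)
  obtain k' where k': "k = Suc k'" using assms by (cases k) auto
  have "2 * int (k_rank_exponent k m r) = 2 * int ((k - 1) * (r * r)) + 2 * int e + 2 * (\<bar>m\<bar> * int r)"
    unfolding k_rank_exponent_eq[OF assms] e by (simp add: k' algebra_simps)
  moreover have "int (nat \<bar>m\<bar> * r) = \<bar>m\<bar> * int r" by simp
  ultimately have "k_rank_exponent k m r = (k - 1) * (r * r) + (e + nat \<bar>m\<bar> * r)"
    by linarith
  then show ?thesis unfolding k_rank_term_def bailey_alpha_def e_def by (simp only: power_add mult_ac)
qed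

lemma eq_upto_k_rank_term: 
  assumes "k \<ge> 1" "n + 1 < r"
  shows "eq_upto n (k_rank_term k m r) 0"
proof -
  have "k_rank_term k m r = fps_X ^ k_rank_exponent k m r * ((- 1) ^ (r - 1) * (1 - fps_X ^ r))"
    by (simp add: k_rank_term_def mult_ac)
  moreover have "n < k_rank_exponent k m r"
    using le_k_rank_exponent[OF assms(1), of r m] assms(2) by linarith
  ultimately show ?thesis by (simp add: eq_upto_X_mult)
qed

lemma eq_upto_k_rank_series:
  assumes "k \<ge> 1" "n < L"
  shows "eq_upto n (\<Sum>j. k_rank_term k m (Suc j)) (\<Sum>r=1..L. k_rank_term k m r)"
proof -
  let ?t = "\<lambda>j. k_rank_term k m (Suc j)"
  have "(\<lambda>N. \<Sum>j<N. ?t j) \<longlonglongrightarrow> (\<Sum>j. ?t j)"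
    using summable_sums[OF summable_k_rank_term[OF assms(1)]] by (simp add: sums_def)
  then have ev: "\<forall>\<^sub>F N in sequentially. fps_nth (\<Sum>j<N. ?t j) i = fps_nth (\<Sum>j. ?t j) i" for i
    by (simp add: tendsto_fps_iff)
  have stable: "eq_upto n (\<Sum>j<N. ?t j) (\<Sum>j<L. ?t j)" if "L \<le> N" for N
    using that
  proof (induction N rule: dec_induct)
    case (step N)
    have "eq_upto n (?t N) 0" using assms step by (intro eq_upto_k_rank_term) auto
    then show ?case using step by (simp add: eq_upto_def)
  qed simp
  have "fps_nth (\<Sum>j. ?t j) i = fps_nth (\<Sum>j<L. ?t j) i" if "i \<le> n" for i
  proof -
    have "\<forall>\<^sub>F N in sequentially. N \<ge> L \<and> fps_nth (\<Sum>j<N. ?t j) i = fps_nth (\<Sum>j. ?t j) i"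
      using ev eventually_ge_at_top[of L] by (rule eventually_conj[rotated])
    then obtain N where "N \<ge> L" "fps_nth (\<Sum>j<N. ?t j) i = fps_nth (\<Sum>j. ?t j) i"
      by (auto simp: eventually_at_top_linorder)
    then show ?thesis using stable[of N] that by (simp add: eq_upto_def)
  qed
  moreover have "(\<Sum>j<L. ?t j) = (\<Sum>r=1..L. k_rank_term k m r)"
    by (rule sum.reindex_bij_witness[of _ "\<lambda>r. r - 1" Suc]) auto
  ultimately show ?thesis by (simp add: eq_upto_def)
qed

text \<open>
  The finite identity \<open>bailey_beta_eq\<close> for \<open>bailey_beta (k - 1) m L\<close> is read modulo $q^{n+1}$
  in two ways: in its closed form both reciprocal factors become $1/(q;q)_\infty$, in its recursive form one does. One
  factor then cancels. The bound on \<open>L\<close> makes every index \<open>L - r\<close> that matters exceed \<open>n\<close>.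
\<close>
lemma k_rank_gf_multisum:
  assumes k: "k \<ge> 2" and L: "L \<ge> 2 * n + 2"
  shows "eq_upto n (k_rank_gf k m) (\<Sum>i=1..L. fps_X ^ (i * i) * bailey_beta (k - 2) m i)"
proof -
  let ?R = "\<Sum>r=1..L. k_rank_term k m r"
  let ?D = "\<Sum>i=1..L. fps_X ^ (i * i) * bailey_beta (k - 2) m i"
  obtain k' where k': "k = Suc (Suc k')" using k by (metis add_2_eq_Suc le_Suc_ex)
  have zero: "eq_upto n (f * g) (f' * g')" if "eq_upto n f 0" "eq_upto n f' 0" for f g f' g'
    using eq_upto_mult[OF that(1) eq_upto_refl[of n g]] eq_upto_mult[OF that(2) eq_upto_refl[of n g']]
    by (simp add: eq_upto_def)
  have "eq_upto n (bailey_beta (k - 1) m L) (\<Sum>r=1..L. k_rank_term k m r * (qpoch_inf_inv * qpoch_inf_inv))"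
  proof -
    have "bailey_beta (k - 1) m L = (\<Sum>r=1..L. k_rank_term k m r * (qpoch_inv (L - r) * qpoch_inv (L + r)))"
      unfolding bailey_beta_eq using k by (intro sum.cong refl) (simp add: k_rank_term_eq_alpha mult_ac)
    moreover have "eq_upto n (k_rank_term k m r * (qpoch_inv (L - r) * qpoch_inv (L + r))) (k_rank_term k m r * (qpoch_inf_inv * qpoch_inf_inv))" for r
    proof (cases "r \<le> n + 1")
      case True
      then show ?thesis using L by (intro eq_upto_mult eq_upto_refl eq_upto_qpoch_inv) auto
    next
      case False
      then show ?thesis using k by (intro zero eq_upto_k_rank_term) auto
    qed
    ultimately show ?thesis by (simp add: eq_upto_sum)
  qed
  also have "(\<Sum>r=1..L. k_rank_term k m r * (qpoch_inf_inv * qpoch_inf_inv)) = ?R * (qpoch_inf_inv * qpoch_inf_inv)"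
    by (simp only: sum_distrib_right)
  finally have 1: "eq_upto n (bailey_beta (k - 1) m L) (?R * (qpoch_inf_inv * qpoch_inf_inv))" .
  have "eq_upto n (bailey_beta (k - 1) m L) (\<Sum>i=1..L. fps_X ^ (i * i) * qpoch_inf_inv * bailey_beta (k - 2) m i)"
  proof -
    have "eq_upto n (fps_X ^ (i * i) * qpoch_inv (L - i)) (fps_X ^ (i * i) * qpoch_inf_inv)" for i
    proof (cases "i \<le> n + 1")
      case True
      then show ?thesis using L by (intro eq_upto_mult eq_upto_refl eq_upto_qpoch_inv) auto
    next
      case False
      moreover have "i \<le> i * i" by (cases i) auto
      ultimately have "n < i * i" by linarith
      then have "eq_upto n (fps_X ^ (i * i)) 0" using eq_upto_X_mult[of n "i * i" 1] by simp
      then show ?thesis by (intro zero)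
    qed
    then have "eq_upto n (\<Sum>i=1..L. fps_X ^ (i * i) * qpoch_inv (L - i) * bailey_beta k' m i)
        (\<Sum>i=1..L. fps_X ^ (i * i) * qpoch_inf_inv * bailey_beta k' m i)"
      by (intro eq_upto_sum eq_upto_mult[OF _ eq_upto_refl])
    then show ?thesis by (simp add: k')
  qed
  also have "(\<Sum>i=1..L. fps_X ^ (i * i) * qpoch_inf_inv * bailey_beta (k - 2) m i) = qpoch_inf_inv * ?D"
    by (simp add: sum_distrib_left mult_ac)
  finally have 2: "eq_upto n (bailey_beta (k - 1) m L) (qpoch_inf_inv * ?D)" .
  have "eq_upto n (q_pochhammer_inf * (qpoch_inf_inv * ?D)) (q_pochhammer_inf * (?R * (qpoch_inf_inv * qpoch_inf_inv)))"
    by (rule eq_upto_mult[OF eq_upto_refl eq_upto_trans[OF eq_upto_sym[OF 2] 1]])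
  moreover have "q_pochhammer_inf * (qpoch_inf_inv * ?D) = ?D"
    using q_pochhammer_inf_mult_inv by (simp flip: mult.assoc)
  moreover have "q_pochhammer_inf * (?R * (qpoch_inf_inv * qpoch_inf_inv)) = (q_pochhammer_inf * qpoch_inf_inv) * (qpoch_inf_inv * ?R)"
    by (simp only: mult_ac)
  ultimately have "eq_upto n ?D (qpoch_inf_inv * ?R)" by (simp only: q_pochhammer_inf_mult_inv mult_1_left)
  moreover have "eq_upto n (k_rank_gf k m) (qpoch_inf_inv * ?R)"
    unfolding k_rank_gf_def using k L by (intro eq_upto_mult eq_upto_refl eq_upto_k_rank_series) auto
  ultimately show ?thesis by (metis eq_upto_sym eq_upto_trans)
qed

section \<open>Signs of the multisum and monotonicity\<close>

lemma bailey_beta_1: "bailey_beta j m 1 = fps_X ^ j * crank_part 1 m"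
  by (induction j) (simp_all add: mult.assoc)

lemma nonneg_bailey_beta: "N \<ge> 1 \<Longrightarrow> nonneg (bailey_beta j m N)"
  by (induction j arbitrary: N) (auto intro!: nonneg_crank_part nonneg_sum nonneg_mult)

lemma bailey_beta_Suc_diff:
  assumes "N \<ge> 1"
  shows "(1 - fps_X) * bailey_beta (Suc j) m N = fps_X ^ (N * N) * ((1 - fps_X) * bailey_beta j m N)
    + (\<Sum>i\<in>{1..<N}. fps_X ^ (i * i) * ((1 - fps_X) * qpoch_inv (N - i)) * bailey_beta j m i)"
proof -
  have "{1..N} = insert N {1..<N}" using assms by auto
  then show ?thesis by (simp add: sum_distrib_left distrib_left mult_ac)
qed

lemma nonneg_qpoch_inv_gap: "nonneg ((1 - fps_X) * qpoch_inv (N - i))" if "i \<in> {1..<N}"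
  using that by (intro nonneg_qpoch_inv_diff) auto

lemma X_power_Suc_mult: "fps_X ^ (Suc j * N) = fps_X ^ N * (fps_X ^ (j * N) :: int fps)"
  by (simp add: power_add)

text \<open>
  The only contribution to \<open>(1 - fps_X) * bailey_beta j m N\<close> that can be negative is the one where all
  summation indices equal \<open>N\<close>: otherwise some difference of consecutive indices is positive, and
  its factor \<open>qpoch_inv (N - i)\<close> absorbs \<open>1 - fps_X\<close>.
\<close>
lemma bailey_beta_diff_ge: "N \<ge> 1 \<Longrightarrow> nonneg ((1 - fps_X) * bailey_beta j m N - fps_X ^ (j * (N * N)) * ((1 - fps_X) * crank_part N m))"
proof (induction j)
  case (Suc j)
  have "(1 - fps_X) * bailey_beta (Suc j) m N - fps_X ^ (Suc j * (N * N)) * ((1 - fps_X) * crank_part N m)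
    = fps_X ^ (N * N) * ((1 - fps_X) * bailey_beta j m N - fps_X ^ (j * (N * N)) * ((1 - fps_X) * crank_part N m))
    + (\<Sum>i\<in>{1..<N}. fps_X ^ (i * i) * ((1 - fps_X) * qpoch_inv (N - i)) * bailey_beta j m i)"
    unfolding bailey_beta_Suc_diff[OF Suc.prems] X_power_Suc_mult by (simp add: right_diff_distrib mult.assoc)
  moreover have "nonneg (\<Sum>i\<in>{1..<N}. fps_X ^ (i * i) * ((1 - fps_X) * qpoch_inv (N - i)) * bailey_beta j m i)"
    by (intro nonneg_sum nonneg_mult nonneg_qpoch_inv_gap nonneg_bailey_beta) auto
  ultimately show ?case
    using nonneg_add[OF nonneg_mult[OF nonneg_simps(3) Suc.IH[OF Suc.prems]]] by (simp only:)
qed simp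

text \<open>
  The same bound with one of the discarded nonnegative contributions retained.
\<close>
lemma bailey_beta_diff_ge_extra:
  assumes i0: "i0 \<in> {1..<N}"
  shows "nonneg ((1 - fps_X) * bailey_beta (Suc j) m N - fps_X ^ (Suc j * (N * N)) * ((1 - fps_X) * crank_part N m)
    - fps_X ^ (i0 * i0) * ((1 - fps_X) * qpoch_inv (N - i0)) * bailey_beta j m i0)"
proof -
  let ?T = "\<lambda>i. fps_X ^ (i * i) * ((1 - fps_X) * qpoch_inv (N - i)) * bailey_beta j m i"
  have N: "N \<ge> 1" using i0 by auto
  have "(\<Sum>i\<in>{1..<N}. ?T i) = ?T i0 + (\<Sum>i\<in>{1..<N} - {i0}. ?T i)"
    using i0 by (intro sum.remove) auto
  then have "(1 - fps_X) * bailey_beta (Suc j) m N - fps_X ^ (Suc j * (N * N)) * ((1 - fps_X) * crank_part N m) - ?T i0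
    = fps_X ^ (N * N) * ((1 - fps_X) * bailey_beta j m N - fps_X ^ (j * (N * N)) * ((1 - fps_X) * crank_part N m))
    + (\<Sum>i\<in>{1..<N} - {i0}. ?T i)"
    unfolding bailey_beta_Suc_diff[OF N] X_power_Suc_mult by (simp add: right_diff_distrib mult.assoc)
  moreover have "nonneg (\<Sum>i\<in>{1..<N} - {i0}. ?T i)"
    by (intro nonneg_sum nonneg_mult nonneg_qpoch_inv_gap nonneg_bailey_beta) auto
  ultimately show ?thesis
    using nonneg_add[OF nonneg_mult[OF nonneg_simps(3) bailey_beta_diff_ge[OF N]]] by (simp only:)
qed

lemma nth_mult_ge_1:
  assumes "nonneg f" "nonneg g" "1 \<le> fps_nth f a" "1 \<le> fps_nth g b"
  shows "1 \<le> fps_nth (f * g) (a + b)"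
proof -
  have "1 \<le> fps_nth f a * fps_nth g b" using mult_mono[OF assms(3,4)] assms(3) by simp
  also have "\<dots> = fps_nth f a * fps_nth g (a + b - a)" by simp
  also have "\<dots> \<le> (\<Sum>i=0..a + b. fps_nth f i * fps_nth g (a + b - i))"
    by (rule member_le_sum) (use assms in \<open>auto simp: nonneg_def\<close>)
  finally show ?thesis by (simp add: fps_mult_nth)
qed

lemma geom_nth: "fps_nth (geom i) n = (if i dvd n then 1 else 0)"
  by (simp add: geom_def)

lemma qpoch_inv_diff: "(1 - fps_X) * qpoch_inv 1 = 1" "(1 - fps_X) * qpoch_inv 2 = geom 2" "(1 - fps_X) * qpoch_inv 3 = geom 2 * geom 3"
  using geom_mult[of 1] by (simp_all add: qpoch_inv_def numeral_2_eq_2 numeral_3_eq_3 mult_ac)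

text \<open>
  With \<open>s = k - 1 + |m|\<close> the two series come from the index tuples $(1,\dots,1)$ and
  $(2,1,\dots,1)$. Their sum is $q^s(1-q+q^3)/(1-q^2)$, whose only negative coefficient is at
  \<open>s + 1\<close>.
\<close>
lemma all_ones_tuples_nonneg:
  assumes "t \<noteq> s + 1"
  shows "0 \<le> fps_nth (fps_X ^ s * ((1 - fps_X) * geom 2)) t + fps_nth (fps_X ^ (s + 3) * geom 2) t"
proof -
  have "fps_nth ((1 - fps_X) * geom 2) n = (if even n then 1 else - 1)" for n
    by (cases n) (auto simp: left_diff_distrib geom_nth)
  moreover have "t - (s + 3) = t - s - 3" by simp
  moreover have "even (t - s - 3)" if "odd (t - s)" "t - s \<ge> 3" using that by simp
  moreover have "t - s \<ge> 3 \<longleftrightarrow> t \<ge> s + 3" by auto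
  moreover have "odd (t - s) \<Longrightarrow> t - s \<ge> 3" using assms by presburger
  ultimately show ?thesis unfolding fps_X_power_mult_nth geom_nth by (simp add: not_less)
qed

lemma k_rank_gf_diff:
  assumes "k \<ge> 2" "L \<ge> 2 * n + 4"
  shows "N_rank k m (n + 1) - N_rank k m n
    = (\<Sum>i=1..L. fps_nth (fps_X ^ (i * i) * ((1 - fps_X) * bailey_beta (k - 2) m i)) (n + 1))"
proof -
  have "eq_upto (n + 1) ((1 - fps_X) * k_rank_gf k m) ((1 - fps_X) * (\<Sum>i=1..L. fps_X ^ (i * i) * bailey_beta (k - 2) m i))"
    using assms by (intro eq_upto_mult eq_upto_refl k_rank_gf_multisum) auto
  moreover have "(1 - fps_X) * (\<Sum>i=1..L. fps_X ^ (i * i) * bailey_beta (k - 2) m i)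
    = (\<Sum>i=1..L. fps_X ^ (i * i) * ((1 - fps_X) * bailey_beta (k - 2) m i))"
    by (simp add: sum_distrib_left mult_ac)
  ultimately have "fps_nth ((1 - fps_X) * k_rank_gf k m) (n + 1)
    = (\<Sum>i=1..L. fps_nth (fps_X ^ (i * i) * ((1 - fps_X) * bailey_beta (k - 2) m i)) (n + 1))"
    by (simp add: eq_upto_def fps_sum_nth)
  then show ?thesis by (simp add: N_rank_def left_diff_distrib)
qed

theorem theorem1p8:
  fixes k n :: nat and m :: int
  assumes "k \<ge> 3"
    and "n \<ge> k - 1"
    and "int n \<noteq> \<bar>m\<bar> + int k - 1"
    and "(k, m, n) \<noteq> (3, 0, 8)"
  shows "N_rank k m (n + 1) \<ge> N_rank k m n"
proof -
  define j where "j = k - 3"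
  have k: "k = j + 3" using assms(1) by (simp add: j_def)
  define t where "t = n + 1"
  define L where "L = 2 * n + 4"
  have L4: "4 \<le> L" by (simp add: L_def)
  \<comment> \<open>Contributions to the difference: \<open>h N\<close> from the tuples with largest index \<open>N\<close>,
    \<open>v N\<close> from the tuple with all indices equal to \<open>N\<close>, and \<open>u\<close> from \<open>(2, 1, ..., 1)\<close>.\<close>
  define h where "h N = fps_nth (fps_X ^ (N * N) * ((1 - fps_X) * bailey_beta (Suc j) m N)) t" for N
  define v where "v N = fps_nth (fps_X ^ ((j + 2) * (N * N)) * ((1 - fps_X) * crank_part N m)) t" for N
  define u where "u = fps_nth (fps_X ^ (k + 2 + nat \<bar>m\<bar>) * geom 2) t"
  have diff: "N_rank k m (n + 1) - N_rank k m n = (\<Sum>N=1..L. h N)"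
    using k_rank_gf_diff[of k n L m] by (simp add: h_def t_def L_def k)
  have v_pow: "fps_X ^ ((j + 2) * (N * N)) = fps_X ^ (N * N) * (fps_X ^ (Suc j * (N * N)) :: int fps)" for N
    by (simp flip: power_add)
  have h_ge: "v N \<le> h N" if "N \<ge> 1" for N
  proof -
    have "0 \<le> fps_nth (fps_X ^ (N * N) * ((1 - fps_X) * bailey_beta (Suc j) m N - fps_X ^ (Suc j * (N * N)) * ((1 - fps_X) * crank_part N m))) t"
      using that by (intro nonneg_D nonneg_mult nonneg_simps bailey_beta_diff_ge)
    then show ?thesis
      unfolding h_def v_def v_pow right_diff_distrib[of "fps_X ^ (N * N)"] by (simp add: mult.assoc)
  qed
  have h_ge_extra: "v N + fps_nth (fps_X ^ (N * N) * (fps_X ^ (i0 * i0) * ((1 - fps_X) * qpoch_inv (N - i0)) * bailey_beta j m i0)) t \<le> h N"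
    if "i0 \<in> {1..<N}" for i0 N
  proof -
    have "0 \<le> fps_nth (fps_X ^ (N * N) * ((1 - fps_X) * bailey_beta (Suc j) m N - fps_X ^ (Suc j * (N * N)) * ((1 - fps_X) * crank_part N m)
       - fps_X ^ (i0 * i0) * ((1 - fps_X) * qpoch_inv (N - i0)) * bailey_beta j m i0)) t"
      using that by (intro nonneg_D nonneg_mult nonneg_simps bailey_beta_diff_ge_extra)
    then show ?thesis
      unfolding h_def v_def v_pow right_diff_distrib[of "fps_X ^ (N * N)"] by (simp add: mult.assoc)
  qed
  have h_2: "v 2 + u \<le> h 2"
  proof -
    have P1: "(1 - fps_X) * qpoch_inv (2 - 1) = 1" using qpoch_inv_diff(1) by simp
    have "fps_X ^ (2 * 2) * (fps_X ^ (1 * 1) * ((1 - fps_X) * qpoch_inv (2 - 1)) * bailey_beta j m 1)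
      = fps_X ^ (2 * 2 + 1 * 1 + j + nat \<bar>m\<bar>) * geom 2"
      unfolding P1 bailey_beta_1 crank_part_1 by (simp only: power_add mult_ac mult_1_left mult_1_right)
    moreover have "2 * 2 + 1 * 1 + j + nat \<bar>m\<bar> = k + 2 + nat \<bar>m\<bar>" by (simp add: k)
    ultimately show ?thesis using h_ge_extra[of 1 2] by (simp only: u_def) simp
  qed
  have h_1: "0 \<le> h 1 + u"
  proof -
    have "h 1 = fps_nth (fps_X ^ (k - 1 + nat \<bar>m\<bar>) * ((1 - fps_X) * geom 2)) t"
      unfolding h_def bailey_beta_1 crank_part_1 by (simp add: k power_add mult_ac)
    moreover have "t \<noteq> k - 1 + nat \<bar>m\<bar> + 1" using assms(1,3) by (simp add: t_def)
    moreover have "k + 2 + nat \<bar>m\<bar> = k - 1 + nat \<bar>m\<bar> + 3" using assms(1) by simp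
    ultimately show ?thesis using all_ones_tuples_nonneg[of t "k - 1 + nat \<bar>m\<bar>"] by (simp only: u_def simp_thms)
  qed
  have v_dC: "v N = (if t < (j + 2) * (N * N) then 0 else crank_diff N m (t - (j + 2) * (N * N)))" for N
    unfolding v_def fps_X_power_mult_nth crank_diff_def ..
  have v_nonneg: "0 \<le> v N" if "N \<ge> 2" "m \<noteq> 0 \<or> t \<noteq> (j + 2) * (N * N) + 1" for N
  proof (cases "t < (j + 2) * (N * N)")
    case False
    then have "m \<noteq> 0 \<or> t - (j + 2) * (N * N) \<noteq> 1" using that(2) by linarith
    then have "0 \<le> crank_diff N m (t - (j + 2) * (N * N))" using crank_diff_bounds[OF that(1)] by blast
    then show ?thesis using False by (simp only: v_dC if_False)
  qed (simp only: v_dC if_True)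
  have split: "(\<Sum>N=1..L. h N) = h 1 + (\<Sum>N\<in>{2..L}. h N)"
    using L4 by (simp add: sum.atLeast_Suc_atMost numeral_2_eq_2)
  have low: "(\<Sum>N\<in>{2..L}. v N) + u \<le> (\<Sum>N\<in>{2..L}. h N)"
  proof -
    have "(\<Sum>N\<in>{2..L}. v N + (if N = 2 then u else 0)) \<le> (\<Sum>N\<in>{2..L}. h N)"
      using h_ge h_2 by (intro sum_mono) auto
    then show ?thesis using L4 by (simp add: sum.distrib)
  qed
  show ?thesis
  proof (cases "\<exists>N0\<ge>2. m = 0 \<and> t = (j + 2) * (N0 * N0) + 1")
    case False
    have "0 \<le> v N" if "N \<ge> 2" for N
      using False that by (intro v_nonneg) auto
    then have "0 \<le> (\<Sum>N\<in>{2..L}. v N)" by (intro sum_nonneg) auto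
    then show ?thesis using diff split low h_1 by linarith
  next
    case True
    then obtain N0 where N0: "N0 \<ge> 2" and m: "m = 0" and t: "t = (j + 2) * (N0 * N0) + 1" by blast
    have v_N0: "- 1 \<le> v N0" using crank_diff_bounds[OF N0] by (simp add: v_dC m t)
    have v_other: "0 \<le> v N" if "N \<ge> 2" "N \<noteq> N0" for N
    proof -
      have "N * N \<noteq> N0 * N0" using that(2) by (metis power2_eq_square power2_eq_iff_nonneg zero_le)
      then have "(j + 2) * (N * N) \<noteq> (j + 2) * (N0 * N0)" by (subst mult_cancel1) simp
      then show ?thesis using t by (intro v_nonneg that) simp
    qed
    have v_ge: "- 1 \<le> (\<Sum>N\<in>{2..L}. v N)"
    proof -
      have "(\<Sum>N\<in>{2..L}. if N = N0 then - 1 else 0) \<le> (\<Sum>N\<in>{2..L}. v N)"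
        using v_N0 v_other by (intro sum_mono) auto
      moreover have "- 1 \<le> (\<Sum>N\<in>{2..L}. if N = N0 then - 1 else 0 :: int)" by simp
      ultimately show ?thesis by linarith
    qed
    have collect: "fps_X ^ a * (fps_X ^ b * q * (fps_X ^ c * g)) = fps_X ^ (a + b + c) * (g * q)"
      for a b c and g q :: "int fps" by (simp only: power_add mult_ac)
    have C1: "crank_part 1 m = geom 2" using crank_part_1[of m] by (simp add: m)
    have shift: "1 \<le> fps_nth (fps_X ^ s * f) t" if "s \<le> t" "1 \<le> fps_nth f (t - s)" for s and f :: "int fps"
      using that by (simp add: fps_X_power_mult_nth)
    \<comment> \<open>The single loss of 1 at \<open>N0\<close> is made up by a discarded tuple with largest index 3 or 4.\<close>
    have "\<exists>N\<in>{3, 4}. v N + 1 \<le> h N"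
    proof -
      consider "j = 0" "N0 \<ge> 3" | "j = 1" "N0 = 2" | "j \<ge> 1" "13 + j \<le> t"
      proof -
        have N03: "9 \<le> N0 * N0" if "N0 \<ge> 3" using mult_le_mono[OF that that] by simp
        have "13 + j \<le> t" if "N0 \<ge> 3"
          using mult_le_mono2[OF N03[OF that], of "j + 2"] unfolding t by simp
        moreover have "13 + j \<le> t" if "N0 = 2" "j \<ge> 2" using that unfolding t by simp
        moreover have "N0 \<noteq> 2" if "j = 0" using assms(4) t m that by (auto simp: k t_def)
        ultimately show ?thesis using that N0 by (metis One_nat_def Suc_1 le_antisym less_one not_less not_less_eq_eq numeral_3_eq_3)
      qed
      then show ?thesis
      proof cases
        case 1
        have "9 \<le> N0 * N0" using mult_le_mono[OF 1(2) 1(2)] by simp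
        then have t19: "19 \<le> t" using 1 t by simp
        \<comment> \<open>\<open>k = 3\<close>: the tuple \<open>(4, 1)\<close>.\<close>
        have P3: "(1 - fps_X) * qpoch_inv (4 - 1) = geom 2 * geom 3" using qpoch_inv_diff(3) by simp
        have "fps_X ^ (4 * 4) * (fps_X ^ (1 * 1) * ((1 - fps_X) * qpoch_inv (4 - 1)) * bailey_beta j m 1) = fps_X ^ 17 * (geom 2 * (geom 2 * geom 3))"
          unfolding P3 bailey_beta_1 C1 collect by (simp add: 1(1))
        moreover have "1 \<le> fps_nth (geom 2 * (geom 2 * geom 3)) (t - 17)"
        proof (cases "even (t - 17)")
          case True
          have "1 \<le> fps_nth (geom 2 * (geom 2 * geom 3)) (t - 17 + (0 + 0))"
            using True by (intro nth_mult_ge_1 nonneg_mult nonneg_simps) (simp_all add: geom_nth)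
          then show ?thesis by simp
        next
          case False
          then have "t - 20 + 3 = t - 17" "even (t - 20)" using t19 by presburger+
          moreover have "1 \<le> fps_nth (geom 2 * (geom 2 * geom 3)) (t - 20 + (0 + 3))"
            using \<open>even (t - 20)\<close> by (intro nth_mult_ge_1 nonneg_mult nonneg_simps) (simp_all add: geom_nth)
          ultimately show ?thesis by simp
        qed
        ultimately have "v 4 + 1 \<le> h 4" using h_ge_extra[of 1 4] shift[of 17 "geom 2 * (geom 2 * geom 3)"] t19 by simp
        then show ?thesis by blast
      next
        case 2
        then have t13: "t = 13" using t by simp
        \<comment> \<open>\<open>k = 4\<close> and \<open>N0 = 2\<close>: the tuple \<open>(3, 1, 1)\<close>.\<close>
        have P2: "(1 - fps_X) * qpoch_inv (3 - 1) = geom 2" using qpoch_inv_diff(2) by simp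
        have "fps_X ^ (3 * 3) * (fps_X ^ (1 * 1) * ((1 - fps_X) * qpoch_inv (3 - 1)) * bailey_beta j m 1) = fps_X ^ 11 * (geom 2 * geom 2)"
          unfolding P2 bailey_beta_1 C1 collect by (simp add: 2(1))
        moreover have "1 \<le> fps_nth (geom 2 * geom 2) (t - 11)"
          using nth_mult_ge_1[of "geom 2" "geom 2" 0 2] by (simp add: geom_nth t13 numeral_2_eq_2)
        ultimately have "v 3 + 1 \<le> h 3" using h_ge_extra[of 1 3] shift[of 11 "geom 2 * geom 2"] t13 by simp
        then show ?thesis by blast
      next
        case 3
        \<comment> \<open>All other cases: the tuple \<open>(3, 2, 1, ..., 1)\<close>.\<close>
        obtain i where i: "j = Suc i" using 3 by (cases j) auto
        have "1 \<le> fps_nth (geom 1 * geom 2) (t - (14 + i) + 0)"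
          by (intro nth_mult_ge_1 nonneg_simps) (simp_all add: geom_nth)
        then have "1 \<le> fps_nth (fps_X ^ (14 + i) * (geom 1 * geom 2)) t" using 3 i by (intro shift) auto
        also have "\<dots> \<le> fps_nth (fps_X ^ 13 * bailey_beta j m 2) t"
        proof -
          have b2: "bailey_beta j m 2 = fps_X ^ 1 * qpoch_inv 1 * (fps_X ^ i * geom 2) + fps_X ^ 4 * bailey_beta i m 2"
          proof -
            have two: "{1..2} = {1, 2 :: nat}" by auto
            show ?thesis unfolding i bailey_beta.simps two bailey_beta_1[of i m, unfolded C1, symmetric] by simp
          qed
          have P1: "qpoch_inv 1 = geom 1" by (simp add: qpoch_inv_def)
          have "fps_X ^ 13 * (fps_X ^ 4 * bailey_beta i m 2) = fps_X ^ (13 + 4) * bailey_beta i m 2"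
            by (simp only: power_add mult.assoc)
          then have "fps_X ^ 13 * bailey_beta j m 2 = fps_X ^ (13 + 1 + i) * (geom 2 * geom 1) + fps_X ^ 17 * bailey_beta i m 2"
            unfolding b2 distrib_left collect P1 by simp
          moreover have "0 \<le> fps_nth (fps_X ^ 17 * bailey_beta i m 2) t"
            by (intro nonneg_D nonneg_mult nonneg_simps nonneg_bailey_beta) simp
          ultimately show ?thesis by (simp add: mult.commute)
        qed
        also have "fps_X ^ 13 * bailey_beta j m 2 = fps_X ^ (3 * 3) * (fps_X ^ (2 * 2) * ((1 - fps_X) * qpoch_inv (3 - 2)) * bailey_beta j m 2)"
        proof -
          have P1: "(1 - fps_X) * qpoch_inv (3 - 2) = 1" using qpoch_inv_diff(1) by simp
          have "fps_X ^ (3 * 3 + 2 * 2) * f = fps_X ^ (3 * 3) * (fps_X ^ (2 * 2) * 1 * f)" for f :: "int fps"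
            by (simp only: power_add mult.assoc mult_1_left)
          then show ?thesis unfolding P1 by simp
        qed
        finally have "v 3 + 1 \<le> h 3" using h_ge_extra[of 2 3] by simp
        then show ?thesis by blast
      qed
    qed
    then obtain Nc where Nc: "Nc \<in> {3, 4}" "v Nc + 1 \<le> h Nc" by blast
    have "(\<Sum>N\<in>{2..L}. v N + (if N = 2 then u else 0) + (if N = Nc then 1 else 0)) \<le> (\<Sum>N\<in>{2..L}. h N)"
      using h_ge h_2 Nc by (intro sum_mono) auto
    then have "(\<Sum>N\<in>{2..L}. v N) + u + 1 \<le> (\<Sum>N\<in>{2..L}. h N)"
      using L4 Nc(1) by (auto simp: sum.distrib)
    then show ?thesis using v_ge diff split h_1 by linarith
  qed
qed

end
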